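(* Let $z$ be a point with $d(z,\mathcal{M})<C\sigma$ and projection $z^*$ onto $\mathcal{M}$. Let $r_1=c\sigma$, $r_2=C\sigma\sqrt{\log(1/\sigma)}$, and $$\mathbb{V}_z=\{w\in\mathbb{R}^D:\ \|\Pi^-_{z^*}(w-z)\|_2\le r_1,\ \|\Pi^\perp_{z^*}(w-z)\|_2\le r_2\},$$ i.e. the product of a $d$-dimensional ball of radius $r_1$ in the tangent directions and a $(D-d)$-dimensional ball of radius $r_2$ in the normal directions, centered at $z$. Define $\mu_z^{\mathbb{V}}=z+\Pi^\perp_{z^*}\mathbb{E}_{Y\sim\nu}(Y-z\mid Y\in\mathbb{V}_z)$. Then $d(\mu_z^{\mathbb{V}},\mathcal{M})\le C\sigma^2\log(1/\sigma)$ for some constant $C$.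
   Context: Model: $\mathcal{M}\subset\mathbb{R}^D$ is a compact, twice-differentiable, $d$-dimensional embedded submanifold with $d$-dimensional Hausdorff volume at most $V$ and reach at least $\tau>0$. $X$ is uniform on $\mathcal{M}$, $\xi\sim N(0,\sigma^2I_D)$ independent, and $Y=X+\xi$ has density $\nu$. $z^*=\arg\min_{x\in\mathcal{M}}\|x-z\|_2$; $\Pi^-_{x}$ and $\Pi^\perp_x=I_D-\Pi^-_x$ are the orthogonal projections onto the tangent space $T_x\mathcal{M}$ and the normal space at $x$. $\sigma$ is sufficiently small; $c<1$, $C>1$ are constants independent of $\sigma$. *)

theory Defs
  imports "HOL-Analysis.Analysis"
begin

definition hausdorff_pre :: "nat \<Rightarrow> real \<Rightarrow> 'a::euclidean_space set \<Rightarrow> ennreal" where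
  "hausdorff_pre d \<delta> A =
     (INF S \<in> {S :: nat \<Rightarrow> 'a set. A \<subseteq> (\<Union>i. S i) \<and> (\<forall>i. bounded (S i) \<and> diameter (S i) \<le> \<delta>)}.
        (\<Sum>i. ennreal (unit_ball_vol (real d) * (diameter (S i) / 2) ^ d)))"

definition hausdorff :: "nat \<Rightarrow> 'a::euclidean_space set \<Rightarrow> ennreal" where
  "hausdorff d A = (SUP \<delta> \<in> {0<..}. hausdorff_pre d \<delta> A)"

definition hausdorff_on :: "nat \<Rightarrow> 'a::euclidean_space set \<Rightarrow> 'a measure" where
  "hausdorff_on d M = measure_of UNIV (sets borel) (\<lambda>A. hausdorff d (A \<inter> M))"

definition twice_diff_chart :: "'a::euclidean_space set \<Rightarrow> 'b::euclidean_space set \<Rightarrow> ('b \<Rightarrow> 'a) \<Rightarrow> 'a set \<Rightarrow> bool" where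
  "twice_diff_chart M W \<phi> U \<longleftrightarrow>
     open W \<and> open U \<and> \<phi> ` W = M \<inter> U \<and> inj_on \<phi> W \<and>
     continuous_on W \<phi> \<and> continuous_on (M \<inter> U) (inv_into W \<phi>) \<and>
     (\<exists>\<phi>' :: 'b \<Rightarrow> ('b \<Rightarrow>\<^sub>L 'a).
        (\<forall>u\<in>W. (\<phi> has_derivative blinfun_apply (\<phi>' u)) (at u) \<and> inj (blinfun_apply (\<phi>' u))
                 \<and> \<phi>' differentiable (at u)))"

definition twice_diff_submanifold :: "'a::euclidean_space set \<Rightarrow> 'b::euclidean_space itself \<Rightarrow> bool" where
  "twice_diff_submanifold M (_ :: 'b itself) \<longleftrightarrow>
     (\<forall>x\<in>M. \<exists>(W :: 'b set) \<phi> U. x \<in> U \<and> twice_diff_chart M W \<phi> U)"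

definition tangent_space :: "'a::euclidean_space set \<Rightarrow> 'a \<Rightarrow> 'a set" where
  "tangent_space M x =
     {v. \<exists>\<gamma> e. e > 0 \<and> (\<forall>t\<in>{-e<..<e}. \<gamma> t \<in> M) \<and> \<gamma> 0 = x \<and> (\<gamma> has_vector_derivative v) (at 0)}"

definition tan_proj :: "'a::euclidean_space set \<Rightarrow> 'a \<Rightarrow> 'a \<Rightarrow> 'a" where
  "tan_proj M x v =
     (THE p. p \<in> tangent_space M x \<and> (\<forall>t\<in>tangent_space M x. (v - p) \<bullet> t = 0))"

definition nor_proj :: "'a::euclidean_space set \<Rightarrow> 'a \<Rightarrow> 'a \<Rightarrow> 'a" where
  "nor_proj M x v = v - tan_proj M x v"

definition reach :: "'a::euclidean_space set \<Rightarrow> ereal" where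
  "reach M = Sup {ereal r | r. r \<ge> 0 \<and>
      (\<forall>z. infdist z M < r \<longrightarrow> (\<exists>!p. p \<in> M \<and> dist z p = infdist z M))}"

definition nearest :: "'a::metric_space set \<Rightarrow> 'a \<Rightarrow> 'a" where
  "nearest M z = (SOME p. p \<in> M \<and> dist z p = infdist z M)"

definition gauss :: "real \<Rightarrow> 'a::euclidean_space \<Rightarrow> real" where
  "gauss \<sigma> v = exp (- (norm v)\<^sup>2 / (2 * \<sigma>\<^sup>2)) / (2 * pi * \<sigma>\<^sup>2) powr (real DIM('a) / 2)"

text \<open>Density nu of Y = X + xi, X uniform (normalised d-dim Hausdorff measure) on M.\<close>
definition noisy_density :: "nat \<Rightarrow> 'a::euclidean_space set \<Rightarrow> real \<Rightarrow> 'a \<Rightarrow> real" where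
  "noisy_density d M \<sigma> y =
     (\<integral>x. gauss \<sigma> (y - x) \<partial>hausdorff_on d M) / enn2real (hausdorff d M)"

definition box_V :: "'a::euclidean_space set \<Rightarrow> 'a \<Rightarrow> real \<Rightarrow> real \<Rightarrow> 'a set" where
  "box_V M z r1 r2 = {w. norm (tan_proj M (nearest M z) (w - z)) \<le> r1 \<and>
                          norm (nor_proj M (nearest M z) (w - z)) \<le> r2}"

definition mu_V :: "nat \<Rightarrow> 'a::euclidean_space set \<Rightarrow> real \<Rightarrow> 'a \<Rightarrow> real \<Rightarrow> real \<Rightarrow> 'a" where
  "mu_V d M \<sigma> z r1 r2 =
     (let V = box_V M z r1 r2;
          P = (LINT y:V|lborel. noisy_density d M \<sigma> y);
          E = (1 / P) *\<^sub>R (LINT y:V|lborel. noisy_density d M \<sigma> y *\<^sub>R (y - z))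
      in z + nor_proj M (nearest M z) E)"

end

theory Submission
  imports Defs "HOL-Real_Asymp.Real_Asymp"
begin

text \<open>
  Let \<open>p\<close> be the point of \<open>M\<close> nearest to \<open>z\<close>, let \<open>Q\<close> be the projection onto the normal space at \<open>p\<close>, and let
  \<open>r2\<close> be the normal radius of the box. Since \<open>z - p\<close> is normal, the estimator minus \<open>p\<close> is the
  conditional mean of \<open>Q (Y - p)\<close> on the box, and by Fubini it suffices to bound the integral of
  \<open>gauss \<sigma> (y - x) *\<^sub>R Q (y - p)\<close> over the box for each fixed \<open>x\<close> in \<open>M\<close>. If \<open>x\<close> is at distance at least
  \<open>3 r2\<close> from \<open>p\<close>, the whole box lies in the Gaussian tail. Otherwise split \<open>Q (y - p) = Q (x - p) + Q (y - x)\<close>: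
  positive reach gives \<open>|Q (x - p)| \<le> L |x - p|\<^sup>2\<close>, which is of order \<open>\<sigma>\<^sup>2 log (1/\<sigma>)\<close>, and the integral of
  the centred part cancels under reflection of the normal directions about \<open>x\<close>, again up to a tail.
  The tails contribute at most a high power of \<open>\<sigma>\<close>, whereas up to the normalising factor of the Gaussian the
  mass of the box is at least of order \<open>\<sigma> ^ (d + D)\<close>, because the Hausdorff measure of \<open>M\<close> in a ball of radius
  \<open>\<sigma>\<close> is at least of order \<open>\<sigma> ^ d\<close>, uniformly on \<open>M\<close>.
\<close>

subsection \<open>Hausdorff measure\<close>

text \<open>All constants must be uniform over the nearest point, whereas a chart gives only local
  ones: the derivative of a chart is differentiable pointwise, so the quadratic bound it yields
  depends on the base point. Charts therefore serve only to identify the tangent space, to start a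
  tiny ball touching \<open>M\<close> at \<open>p\<close>, and to bound the mass of small balls
  below, where compactness restores uniformity. The reach lets the touching ball grow to a fixed
  radius, whence \<open>L = 2 / \<tau>\<close>. The condition on \<open>C1\<close> balances two
  powers: \<open>r2 ^ 2 = C1 ^ 2 * \<sigma> ^ 2 * ln (1 / \<sigma>)\<close> turns the tail factor
  \<open>exp (- r2 ^ 2 / (8 * \<sigma> ^ 2))\<close> into \<open>\<sigma>\<close> to the power
  \<open>C1 ^ 2 / 8\<close>. With exponent at least \<open>D + d + 2\<close>, division by a mass of
  order \<open>\<sigma> ^ (d + D)\<close> leaves \<open>\<sigma> ^ 2\<close>.
  \<open>measure_of\<close> yields the zero measure for a set function that is not countably
  additive, so \<open>noisy_density\<close> is the intended mixture only because Hausdorff measure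
  is additive on Borel sets. This is why Caratheodory's criterion is proved here.\<close>

text \<open>Caratheodory's argument: the parts \<open>a n\<close> of \<open>A\<close> at distance at
  least \<open>1 / (n + 1)\<close> from \<open>F\<close> exhaust \<open>A - F\<close>, and what
  remains outside \<open>a n\<close> is a union of rings whose total measure is the tail of a
  convergent series.\<close>

lemma metric_outer_measure_splits_closed:
  fixes f :: "'a::metric_space set \<Rightarrow> ennreal"
  assumes emp: "f {} = 0"
    and mono: "\<And>A B. A \<subseteq> B \<Longrightarrow> f A \<le> f B"
    and csa: "\<And>A :: nat \<Rightarrow> 'a set. f (\<Union>i. A i) \<le> (\<Sum>i. f (A i))"
    and metric: "\<And>A B r. 0 < r \<Longrightarrow> (\<And>a b. a \<in> A \<Longrightarrow> b \<in> B \<Longrightarrow> r \<le> dist a b) \<Longrightarrow> f A + f B \<le> f (A \<union> B)"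
    and F: "closed F"
  shows "f (A \<inter> F) + f (A - F) \<le> f A"
proof (cases "f A = \<infinity> \<or> F = {}")
  case True
  then show ?thesis using emp by auto
next
  case False
  then have fin: "f A < \<infinity>" and ne: "F \<noteq> {}" by (auto simp: top.not_eq_extremum)
  define a where "a n = {x \<in> A. 1 / real (Suc n) \<le> infdist x F}" for n
  define R where "R n = a (Suc n) - a n" for n
  have a_mono: "a m \<subseteq> a n" if "m \<le> n" for m n
  proof -
    have "1 / real (Suc n) \<le> 1 / real (Suc m)" using that by (simp add: frac_le)
    then show ?thesis by (auto simp: a_def)
  qed
  have a_A: "a n \<subseteq> A" for n by (auto simp: a_def)
  have R_A: "R n \<subseteq> A" for n using a_A by (auto simp: R_def)
  \<comment> \<open>\<open>infdist\<close> is 1-Lipschitz, so sets on either side of a full ring are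
    at positive distance and the metric hypothesis applies.\<close>
  have sep: "f B + f C \<le> f (B \<union> C)" if B: "B \<subseteq> a m" and C: "C \<subseteq> A - a (Suc m)" for B C m
  proof (rule metric[of "1 / real (Suc m) - 1 / real (Suc (Suc m))"])
    show "0 < 1 / real (Suc m) - 1 / real (Suc (Suc m))"
      using frac_less2[of 1 1 "real (Suc m)" "real (Suc (Suc m))"] by simp
    fix x y assume "x \<in> B" "y \<in> C"
    then have "1 / real (Suc m) \<le> infdist x F" "infdist y F < 1 / real (Suc (Suc m))"
      using B C by (auto simp: a_def)
    then show "1 / real (Suc m) - 1 / real (Suc (Suc m)) \<le> dist x y"
      using infdist_triangle[of x F y] by linarith
  qed
  \<comment> \<open>Two rings of equal parity have a ring between them, so they are separated;
    neighbouring rings need not be. Adding the bounds for \<open>i = 0\<close> and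
    \<open>i = 1\<close> gives a total of at most \<open>2 * f A\<close>. The case
    \<open>n = 0\<close> of the step is separate because \<open>2 * n + i - 1\<close> truncates
    there.\<close>
  have par: "(\<Sum>k<n. f (R (2 * k + i))) \<le> f (\<Union>k<n. R (2 * k + i))" for n i
  proof (induction n)
    case 0
    show ?case by simp
  next
    case (Suc n)
    show ?case
    proof (cases "n = 0")
      case True
      then show ?thesis by (simp add: lessThan_Suc emp)
    next
      case False
      have "(\<Union>k<n. R (2 * k + i)) \<subseteq> a (2 * n + i - 1)"
      proof (intro UN_least)
        fix k assume "k \<in> {..<n}"
        then have "Suc (2 * k + i) \<le> 2 * n + i - 1" by auto
        then show "R (2 * k + i) \<subseteq> a (2 * n + i - 1)"
          using a_mono[of "Suc (2 * k + i)" "2 * n + i - 1"] by (auto simp: R_def)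
      qed
      moreover have "R (2 * n + i) \<subseteq> A - a (Suc (2 * n + i - 1))"
        using False R_A by (auto simp: R_def)
      ultimately have "f (\<Union>k<n. R (2 * k + i)) + f (R (2 * n + i)) \<le> f ((\<Union>k<n. R (2 * k + i)) \<union> R (2 * n + i))"
        by (rule sep)
      also have "(\<Union>k<n. R (2 * k + i)) \<union> R (2 * n + i) = (\<Union>k<Suc n. R (2 * k + i))"
        by (auto simp: less_Suc_eq)
      finally show ?thesis
        using Suc.IH by (auto intro: order_trans add_right_mono)
    qed
  qed
  have par': "(\<Sum>k<n. f (R (2 * k + i))) \<le> f A" for n i
    using par[of i n] mono[of "\<Union>k<n. R (2 * k + i)" A] R_A by (meson UN_least order_trans)
  have "(\<Sum>k<n. f (R k)) \<le> f A + f A" for n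
  proof -
    have "(\<Sum>k<n. f (R k)) \<le> (\<Sum>k<2*n. f (R k))"
      by (intro sum_mono2) auto
    also have "\<dots> = (\<Sum>k<n. f (R (2 * k + 0))) + (\<Sum>k<n. f (R (2 * k + 1)))"
      by (induction n) (auto simp: algebra_simps)
    also have "\<dots> \<le> f A + f A"
      by (intro add_mono par')
    finally show ?thesis .
  qed
  then have "(\<Sum>k. f (R k)) \<le> f A + f A"
    by (intro suminf_le_const) auto
  then have Rfin: "(\<Sum>k. f (R k)) < \<infinity>"
    using fin by (auto simp: less_top[symmetric] top_unique)
  \<comment> \<open>The tail of the ring series is expressed by adding a partial sum on the left and
    the whole sum on the right, which avoids subtraction in \<open>ennreal\<close>. The finite whole
    sum is cancelled after the supremum over \<open>n\<close>.\<close>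
  have main: "f (A \<inter> F) + f (A - F) + (\<Sum>k<n. f (R k)) \<le> f A + (\<Sum>k. f (R k))" for n
  proof -
    have "A - F \<subseteq> (\<Union>k. case k of 0 \<Rightarrow> a n | Suc j \<Rightarrow> R (j + n))"
    proof
      fix x assume x: "x \<in> A - F"
      then have "infdist x F > 0"
        using F ne infdist_pos_not_in_closed by blast
      then obtain m where "1 / real (Suc m) < infdist x F"
        using nat_approx_posE by blast
      then have xm: "x \<in> a m" using x by (auto simp: a_def)
      \<comment> \<open>The least layer containing \<open>x\<close>: beyond \<open>n\<close> it
        places \<open>x\<close> in the ring \<open>R (l - 1)\<close>.\<close>
      define l where "l = (LEAST m. x \<in> a m)"
      have l: "x \<in> a l" unfolding l_def using xm by (rule LeastI)
      show "x \<in> (\<Union>k. case k of 0 \<Rightarrow> a n | Suc j \<Rightarrow> R (j + n))"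
      proof (cases "l \<le> n")
        case True
        then have "x \<in> a n" using a_mono l by blast
        then show ?thesis by (intro UN_I[of 0]) auto
      next
        case False
        then have "x \<notin> a (l - 1)" unfolding l_def
          by (metis diff_less less_nat_zero_code l_def not_less_Least zero_less_one linorder_not_le not_gr_zero)
        then have "x \<in> R ((l - 1 - n) + n)" using l False by (auto simp: R_def)
        then show ?thesis by (intro UN_I[of "Suc (l - 1 - n)"]) auto
      qed
    qed
    then have "f (A - F) \<le> (\<Sum>k. f (case k of 0 \<Rightarrow> a n | Suc j \<Rightarrow> R (j + n)))"
      using mono csa by (meson order_trans)
    also have "\<dots> = f (a n) + (\<Sum>k. f (R (k + n)))"
      by (subst suminf_offset[where i=1]) (auto simp: add.commute)
    finally have "f (A - F) \<le> f (a n) + (\<Sum>k. f (R (k + n)))" .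
    moreover have "f (A \<inter> F) + f (a n) \<le> f A"
    proof -
      have "f (A \<inter> F) + f (a n) \<le> f ((A \<inter> F) \<union> a n)"
      proof (rule metric[of "1 / real (Suc n)"])
        fix x y assume "x \<in> A \<inter> F" "y \<in> a n"
        then show "1 / real (Suc n) \<le> dist x y"
          using infdist_le[of x F y] by (auto simp: a_def dist_commute)
      qed auto
      also have "\<dots> \<le> f A" by (intro mono) (auto simp: a_def)
      finally show ?thesis .
    qed
    moreover have "(\<Sum>k. f (R k)) = (\<Sum>k. f (R (k + n))) + (\<Sum>k<n. f (R k))"
      by (rule suminf_offset) auto
    ultimately have "f (A \<inter> F) + f (A - F) + (\<Sum>k<n. f (R k))
        \<le> (f (A \<inter> F) + f (a n)) + ((\<Sum>k. f (R (k + n))) + (\<Sum>k<n. f (R k)))"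
      by (simp add: add.assoc add_mono)
    also have "\<dots> \<le> f A + (\<Sum>k. f (R k))"
      using \<open>f (A \<inter> F) + f (a n) \<le> f A\<close> \<open>(\<Sum>k. f (R k)) = _\<close> by (simp add: add_right_mono)
    finally show ?thesis .
  qed
  have "f (A \<inter> F) + f (A - F) + (\<Sum>k. f (R k)) \<le> f A + (\<Sum>k. f (R k))"
  proof -
    have "f (A \<inter> F) + f (A - F) + (\<Sum>k. f (R k)) = (SUP n. f (A \<inter> F) + f (A - F) + (\<Sum>k<n. f (R k)))"
      by (subst suminf_eq_SUP) (rule ennreal_SUP_add_right, simp)
    also have "\<dots> \<le> f A + (\<Sum>k. f (R k))"
      by (rule SUP_least) (rule main)
    finally show ?thesis .
  qed
  then show ?thesis
    using Rfin by (metis add.commute ennreal_add_left_cancel_le infinity_ennreal_def less_irrefl)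
qed

text \<open>The sets that split every set additively form a sigma-algebra on which an outer measure
  is countably additive; it contains the closed sets, hence all Borel sets.\<close>

lemma metric_outer_measure_borel:
  fixes f :: "'a::metric_space set \<Rightarrow> ennreal"
  assumes emp: "f {} = 0"
    and mono: "\<And>A B. A \<subseteq> B \<Longrightarrow> f A \<le> f B"
    and csa: "\<And>A :: nat \<Rightarrow> 'a set. f (\<Union>i. A i) \<le> (\<Sum>i. f (A i))"
    and metric: "\<And>A B r. 0 < r \<Longrightarrow> (\<And>a b. a \<in> A \<Longrightarrow> b \<in> B \<Longrightarrow> r \<le> dist a b) \<Longrightarrow> f A + f B \<le> f (A \<union> B)"
  shows "countably_additive (sets borel) f"
proof -
  interpret P: sigma_algebra UNIV "Pow UNIV :: 'a set set" by (rule sigma_algebra_Pow)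
  have oms: "outer_measure_space (Pow UNIV) f"
    using emp mono csa
    by (auto simp: outer_measure_space_def positive_def increasing_def countably_subadditive_def)
  let ?L = "lambda_system UNIV (Pow UNIV) f"
  have ms: "measure_space UNIV ?L f"
    by (rule P.caratheodory_lemma[OF oms])
  then interpret L: sigma_algebra UNIV ?L by (simp add: measure_space_def)
  have un: "f (A \<union> B) \<le> f A + f B" for A B
  proof -
    have "f (A \<union> B) \<le> f (\<Union>i. case i of 0 \<Rightarrow> A | Suc 0 \<Rightarrow> B | Suc (Suc _) \<Rightarrow> {})"
    proof (intro mono Un_least)
      show "A \<subseteq> (\<Union>i. case i of 0 \<Rightarrow> A | Suc 0 \<Rightarrow> B | Suc (Suc _) \<Rightarrow> {})"
        by (rule subset_trans[OF _ UN_upper[of 0]]) auto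
      show "B \<subseteq> (\<Union>i. case i of 0 \<Rightarrow> A | Suc 0 \<Rightarrow> B | Suc (Suc _) \<Rightarrow> {})"
        by (rule subset_trans[OF _ UN_upper[of 1]]) auto
    qed
    also have "\<dots> \<le> (\<Sum>i. f (case i of 0 \<Rightarrow> A | Suc 0 \<Rightarrow> B | Suc (Suc _) \<Rightarrow> {}))"
      by (rule csa)
    also have "\<dots> = f A + f B"
      by (subst suminf_offset[where i=2]) (auto simp: emp numeral_2_eq_2)
    finally show ?thesis .
  qed
  have "F \<in> ?L" if F: "closed F" for F
  proof -
    have "f (A \<inter> F) + f (A - F) = f A" for A
    proof (rule antisym)
      show "f (A \<inter> F) + f (A - F) \<le> f A"
        by (rule metric_outer_measure_splits_closed[OF emp mono csa metric F])
      show "f A \<le> f (A \<inter> F) + f (A - F)"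
        using un[of "A \<inter> F" "A - F"] by (simp add: Int_Diff_Un)
    qed
    then show ?thesis using P.lambda_system_eq[of f] by auto
  qed
  then have "sigma_sets UNIV (Collect closed) \<subseteq> ?L"
    by (intro L.sigma_sets_subset) auto
  then have "sets borel \<subseteq> ?L"
    by (simp add: borel_eq_closed sets_measure_of)
  moreover have "countably_additive ?L f" using ms by (simp add: measure_space_def)
  ultimately show ?thesis
    unfolding countably_additive_def by (meson order_trans sets.countable_UN'' sets.countable_nat_UN subset_iff)
qed

section \<open>Hausdorff measure is a metric outer measure\<close>

lemma hausdorff_pre_le:
  assumes "A \<subseteq> (\<Union>i. S i)" "\<And>i. bounded (S i)" "\<And>i. diameter (S i) \<le> \<delta>"
  shows "hausdorff_pre d \<delta> A \<le> (\<Sum>i. ennreal (unit_ball_vol (real d) * (diameter (S i) / 2) ^ d))"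
  unfolding hausdorff_pre_def using assms by (intro INF_lower) auto

lemma hausdorff_pre_mono: "A \<subseteq> B \<Longrightarrow> hausdorff_pre d \<delta> A \<le> hausdorff_pre d \<delta> B"
  unfolding hausdorff_pre_def by (intro INF_superset_mono) auto

lemma hausdorff_pre_antimono: "\<delta> \<le> \<epsilon> \<Longrightarrow> hausdorff_pre d \<epsilon> A \<le> hausdorff_pre d \<delta> A"
  unfolding hausdorff_pre_def by (intro INF_superset_mono) (auto intro: order_trans)

lemma hausdorff_mono: "A \<subseteq> B \<Longrightarrow> hausdorff d A \<le> hausdorff d B"
  unfolding hausdorff_def by (intro SUP_mono) (auto intro: hausdorff_pre_mono)

text \<open>Positive dimension matters: for \<open>d = 0\<close> each empty covering set would have
  weight \<open>0 ^ 0 = 1\<close>, up to the volume factor.\<close>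

lemma hausdorff_empty: "d > 0 \<Longrightarrow> hausdorff d {} = 0"
proof -
  assume d: "d > 0"
  have "hausdorff_pre d \<delta> {} = 0" if "\<delta> > 0" for \<delta>
    using hausdorff_pre_le[of "{}" "\<lambda>_. {}" \<delta> d] that d by (simp add: power_0_left)
  then show ?thesis unfolding hausdorff_def by (intro antisym SUP_least) auto
qed

text \<open>Covers of the \<open>A i\<close> that are optimal up to \<open>e / 2 ^ (i + 1)\<close>
  are merged into one sequence by the pairing function; the errors add up to
  \<open>e\<close>.\<close>

lemma hausdorff_pre_subadditive:
  fixes A :: "nat \<Rightarrow> 'a::euclidean_space set"
  shows "hausdorff_pre d \<delta> (\<Union>i. A i) \<le> (\<Sum>i. hausdorff_pre d \<delta> (A i))"
proof (rule ennreal_le_epsilon)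
  fix e :: real assume e: "0 < e" and fin: "(\<Sum>i. hausdorff_pre d \<delta> (A i)) < top"
  let ?t = "\<lambda>S. ennreal (unit_ball_vol (real d) * (diameter S / 2) ^ d)"
  have "\<exists>S. A i \<subseteq> (\<Union>j. S j) \<and> (\<forall>j. bounded (S j) \<and> diameter (S j) \<le> \<delta>) \<and>
      (\<Sum>j. ?t (S j)) \<le> hausdorff_pre d \<delta> (A i) + ennreal (e * (1/2)^Suc i)" for i
  proof -
    have "hausdorff_pre d \<delta> (A i) < top"
      using fin ennreal_suminf_lessD by blast
    then have "hausdorff_pre d \<delta> (A i) < hausdorff_pre d \<delta> (A i) + ennreal (e * (1/2)^Suc i)"
      using e ennreal_add_left_cancel_less[of "hausdorff_pre d \<delta> (A i)" 0 "ennreal (e * (1/2)^Suc i)"]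
      by (simp add: less_top)
    then show ?thesis
      unfolding hausdorff_pre_def[of d \<delta> "A i"] INF_less_iff by (auto intro: less_imp_le)
  qed
  then obtain S where S: "\<And>i. A i \<subseteq> (\<Union>j. S i j)" "\<And>i j. bounded (S i j)" "\<And>i j. diameter (S i j) \<le> \<delta>"
     and sumS: "\<And>i. (\<Sum>j. ?t (S i j)) \<le> hausdorff_pre d \<delta> (A i) + ennreal (e * (1/2)^Suc i)"
    by metis
  let ?S = "\<lambda>n. S (fst (prod_decode n)) (snd (prod_decode n))"
  have "hausdorff_pre d \<delta> (\<Union>i. A i) \<le> (\<Sum>n. ?t (?S n))"
  proof (rule hausdorff_pre_le)
    show "(\<Union>i. A i) \<subseteq> (\<Union>n. ?S n)"
    proof
      fix x assume "x \<in> (\<Union>i. A i)"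
      then obtain i j where "x \<in> S i j" using S(1) by blast
      then show "x \<in> (\<Union>n. ?S n)" by (intro UN_I[of "prod_encode (i, j)"]) auto
    qed
  qed (use S in auto)
  also have "\<dots> = (\<Sum>i. \<Sum>j. ?t (S i j))"
    by (subst suminf_ennreal_2dimen[symmetric, where f = "\<lambda>(i, j). ?t (S i j)"]) (auto simp: comp_def case_prod_beta)
  also have "\<dots> \<le> (\<Sum>i. hausdorff_pre d \<delta> (A i) + ennreal (e * (1/2)^Suc i))"
    by (intro suminf_le sumS) auto
  also have "\<dots> = (\<Sum>i. hausdorff_pre d \<delta> (A i)) + (\<Sum>i. ennreal (e * (1/2)^Suc i))"
    by (subst suminf_add) auto
  also have "(\<Sum>i. ennreal (e * (1/2)^Suc i)) = ennreal e"
  proof -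
    have "(\<lambda>i. e * (1/2)^Suc i) sums (e * 1)"
      by (intro sums_mult power_half_series)
    then show ?thesis using e by (intro suminf_ennreal_eq) auto
  qed
  finally show "hausdorff_pre d \<delta> (\<Union>i. A i) \<le> (\<Sum>i. hausdorff_pre d \<delta> (A i)) + ennreal e" .
qed

lemma hausdorff_subadditive:
  fixes A :: "nat \<Rightarrow> 'a::euclidean_space set"
  shows "hausdorff d (\<Union>i. A i) \<le> (\<Sum>i. hausdorff d (A i))"
  unfolding hausdorff_def[of d "\<Union>i. A i"]
proof (rule SUP_least)
  fix \<delta> :: real assume "\<delta> \<in> {0<..}"
  then have "hausdorff_pre d \<delta> (A i) \<le> hausdorff d (A i)" for i
    unfolding hausdorff_def by (intro SUP_upper)
  then show "hausdorff_pre d \<delta> (\<Union>i. A i) \<le> (\<Sum>i. hausdorff d (A i))"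
    by (intro order_trans[OF hausdorff_pre_subadditive] suminf_le) auto
qed

text \<open>A covering set of diameter below the separation \<open>r\<close> cannot meet both
  \<open>A\<close> and \<open>B\<close>, so any cover of the union splits into two covers without
  sharing a set.\<close>

lemma hausdorff_pre_separated:
  fixes A B :: "'a::euclidean_space set"
  assumes d: "d > 0" and r: "\<delta> < r" "0 < \<delta>" and AB: "\<And>a b. a \<in> A \<Longrightarrow> b \<in> B \<Longrightarrow> r \<le> dist a b"
  shows "hausdorff_pre d \<delta> A + hausdorff_pre d \<delta> B \<le> hausdorff_pre d \<delta> (A \<union> B)"
  unfolding hausdorff_pre_def[of d \<delta> "A \<union> B"]
proof (rule INF_greatest)
  let ?t = "\<lambda>S::'a set. ennreal (unit_ball_vol (real d) * (diameter S / 2) ^ d)"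
  fix S :: "nat \<Rightarrow> 'a set"
  assume "S \<in> {S. A \<union> B \<subseteq> (\<Union>i. S i) \<and> (\<forall>i. bounded (S i) \<and> diameter (S i) \<le> \<delta>)}"
  then have S: "A \<union> B \<subseteq> (\<Union>i. S i)" "\<And>i. bounded (S i)" "\<And>i. diameter (S i) \<le> \<delta>" by auto
  \<comment> \<open>Sets that miss \<open>A\<close> are replaced by the empty set, whose weight
    vanishes because \<open>d > 0\<close>.\<close>
  define SA where "SA i = (if S i \<inter> A = {} then {} else S i)" for i
  define SB where "SB i = (if S i \<inter> B = {} then {} else S i)" for i
  have "hausdorff_pre d \<delta> A \<le> (\<Sum>i. ?t (SA i))"
    by (rule hausdorff_pre_le) (use S r in \<open>fastforce simp: SA_def\<close>)+
  moreover have "hausdorff_pre d \<delta> B \<le> (\<Sum>i. ?t (SB i))"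
    by (rule hausdorff_pre_le) (use S r in \<open>fastforce simp: SB_def\<close>)+
  moreover have "?t (SA i) + ?t (SB i) \<le> ?t (S i)" for i
  proof -
    have "S i \<inter> A = {} \<or> S i \<inter> B = {}"
    proof (rule ccontr)
      assume "\<not> ?thesis"
      then obtain a b where "a \<in> S i" "a \<in> A" "b \<in> S i" "b \<in> B" by auto
      then have "r \<le> dist a b" "dist a b \<le> diameter (S i)"
        using AB diameter_bounded_bound[OF S(2)] by auto
      then show False using S(3)[of i] r by linarith
    qed
    then show ?thesis using d by (auto simp: SA_def SB_def power_0_left)
  qed
  ultimately have "hausdorff_pre d \<delta> A + hausdorff_pre d \<delta> B \<le> (\<Sum>i. ?t (SA i)) + (\<Sum>i. ?t (SB i))"
    by (intro add_mono)
  also have "\<dots> = (\<Sum>i. ?t (SA i) + ?t (SB i))"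
    by (rule suminf_add) auto
  also have "\<dots> \<le> (\<Sum>i. ?t (S i))"
    by (intro suminf_le) (use \<open>\<And>i. ?t (SA i) + ?t (SB i) \<le> ?t (S i)\<close> in auto)
  finally show "hausdorff_pre d \<delta> A + hausdorff_pre d \<delta> B \<le> (\<Sum>i. ?t (S i))" .
qed

text \<open>Premeasures grow as the mesh shrinks, so the two suprema may be taken along a common
  mesh, and that mesh may be pushed below \<open>r\<close>.\<close>

lemma hausdorff_separated:
  fixes A B :: "'a::euclidean_space set"
  assumes d: "d > 0" and r: "0 < r" and AB: "\<And>a b. a \<in> A \<Longrightarrow> b \<in> B \<Longrightarrow> r \<le> dist a b"
  shows "hausdorff d A + hausdorff d B \<le> hausdorff d (A \<union> B)"
proof -
  have "hausdorff d A + hausdorff d B = (SUP \<delta>\<in>{0<..}. hausdorff_pre d \<delta> A + hausdorff_pre d \<delta> B)"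
    unfolding hausdorff_def
  proof (rule SUP_add_directed_ennreal[symmetric])
    fix i j :: real assume "i \<in> {0<..}" "j \<in> {0<..}"
    then show "\<exists>k\<in>{0<..}. hausdorff_pre d i A + hausdorff_pre d j B \<le> hausdorff_pre d k A + hausdorff_pre d k B"
      by (intro bexI[of _ "min i j"] add_mono hausdorff_pre_antimono) auto
  qed
  also have "\<dots> \<le> hausdorff d (A \<union> B)"
  proof (rule SUP_least)
    fix \<delta> :: real assume "\<delta> \<in> {0<..}"
    define \<epsilon> where "\<epsilon> = min \<delta> (r / 2)"
    have \<epsilon>: "\<epsilon> \<le> \<delta>" "\<epsilon> < r" "0 < \<epsilon>" using \<open>\<delta> \<in> _\<close> r by (auto simp: \<epsilon>_def)
    have "hausdorff_pre d \<delta> A + hausdorff_pre d \<delta> B \<le> hausdorff_pre d \<epsilon> A + hausdorff_pre d \<epsilon> B"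
      by (intro add_mono hausdorff_pre_antimono \<epsilon>)
    also have "\<dots> \<le> hausdorff_pre d \<epsilon> (A \<union> B)"
      by (rule hausdorff_pre_separated[OF d \<epsilon>(2,3) AB])
    also have "\<dots> \<le> hausdorff d (A \<union> B)"
      unfolding hausdorff_def using \<epsilon> by (intro SUP_upper) auto
    finally show "hausdorff_pre d \<delta> A + hausdorff_pre d \<delta> B \<le> hausdorff d (A \<union> B)" .
  qed
  finally show ?thesis .
qed

lemma countably_additive_hausdorff:
  "d > 0 \<Longrightarrow> countably_additive (sets borel) (hausdorff d :: 'a::euclidean_space set \<Rightarrow> ennreal)"
  by (rule metric_outer_measure_borel)
     (auto intro: hausdorff_empty hausdorff_mono hausdorff_subadditive hausdorff_separated)

section \<open>Hausdorff measure restricted to a Borel set\<close>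

lemma space_hausdorff_on [simp]: "space (hausdorff_on d M) = UNIV"
  by (simp add: hausdorff_on_def space_measure_of_conv)

lemma sets_hausdorff_on [simp, measurable_cong]: "sets (hausdorff_on d M) = sets (borel :: 'a::euclidean_space measure)"
  using sets.sigma_sets_eq[of "borel :: 'a measure"]
  by (simp add: hausdorff_on_def sets_measure_of_conv)

lemma emeasure_hausdorff_on:
  fixes M :: "'a::euclidean_space set"
  assumes d: "d > 0" and M: "M \<in> sets borel" and A: "A \<in> sets borel"
  shows "emeasure (hausdorff_on d M) A = hausdorff d (A \<inter> M)"
proof (rule emeasure_measure_of[OF hausdorff_on_def])
  show "positive (sets (hausdorff_on d M)) (\<lambda>A. hausdorff d (A \<inter> M))"
    using d by (simp add: positive_def hausdorff_empty)
  show "countably_additive (sets (hausdorff_on d M)) (\<lambda>A. hausdorff d (A \<inter> M))"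
  proof (rule countably_additiveI)
    fix A :: "nat \<Rightarrow> 'a set"
    assume "range A \<subseteq> sets (hausdorff_on d M)" "disjoint_family A"
    then have "(\<Sum>i. hausdorff d (A i \<inter> M)) = hausdorff d (\<Union>i. A i \<inter> M)"
      using countably_additive_hausdorff[OF d, where 'a='a] M unfolding countably_additive_def
      by (elim allE[of _ "\<lambda>i. A i \<inter> M"]) (auto simp: disjoint_family_on_def image_subset_iff)
    then show "(\<Sum>i. hausdorff d (A i \<inter> M)) = hausdorff d ((\<Union>i. A i) \<inter> M)"
      by (simp only: UN_simps)
  qed
qed (use A in auto)

subsection \<open>Charts of a twice differentiable submanifold\<close>

text \<open>A cover of the image pulls back to a cover of \<open>B\<close> by balls of radius
  diameter over \<open>k\<close>, whose volumes are comparable with the weights. Balls centred at a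
  point of the pulled-back set have twice the ideal radius; this costs the factor
  \<open>2 ^ d\<close> and avoids the isodiametric inequality.\<close>

lemma hausdorff_ge_lipschitz_inverse:
  fixes \<phi> :: "'b::euclidean_space \<Rightarrow> 'a::euclidean_space"
  assumes k: "k > 0" and inv: "\<And>v w. v \<in> B \<Longrightarrow> w \<in> B \<Longrightarrow> k * dist v w \<le> dist (\<phi> v) (\<phi> w)"
  shows "ennreal ((k / 2) ^ DIM('b)) * emeasure lborel B \<le> hausdorff DIM('b) (\<phi> ` B)"
proof -
  let ?d = "DIM('b)"
  let ?t = "\<lambda>S::'a set. unit_ball_vol (real ?d) * (diameter S / 2) ^ ?d"
  have "ennreal ((k / 2) ^ ?d) * emeasure lborel B \<le> hausdorff_pre ?d 1 (\<phi> ` B)"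
    unfolding hausdorff_pre_def
  proof (rule INF_greatest)
    fix S :: "nat \<Rightarrow> 'a set"
    assume "S \<in> {S. \<phi> ` B \<subseteq> (\<Union>i. S i) \<and> (\<forall>i. bounded (S i) \<and> diameter (S i) \<le> 1)}"
    then have S: "\<phi> ` B \<subseteq> (\<Union>i. S i)" "\<And>i. bounded (S i)" by auto
    define v where "v i = (SOME w. w \<in> B \<and> \<phi> w \<in> S i)" for i
    have v: "v i \<in> B \<and> \<phi> (v i) \<in> S i" if "w \<in> B" "\<phi> w \<in> S i" for w i
      using someI[of "\<lambda>w. w \<in> B \<and> \<phi> w \<in> S i" w] that by (simp add: v_def)
    have diam: "0 \<le> diameter (S i)" for i by (rule diameter_ge_0[OF S(2)])
    have "B \<subseteq> (\<Union>i. cball (v i) (diameter (S i) / k))"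
    proof
      fix w assume w: "w \<in> B"
      then obtain i where i: "\<phi> w \<in> S i" using S(1) by auto
      have "k * dist (v i) w \<le> dist (\<phi> (v i)) (\<phi> w)" using v[OF w i] w inv by auto
      also have "\<dots> \<le> diameter (S i)" using v[OF w i] i diameter_bounded_bound[OF S(2)] by auto
      finally show "w \<in> (\<Union>i. cball (v i) (diameter (S i) / k))"
        using k by (intro UN_I[of i]) (auto simp: field_simps)
    qed
    then have "emeasure lborel B \<le> emeasure lborel (\<Union>i. cball (v i) (diameter (S i) / k))"
      by (intro emeasure_mono) auto
    also have "\<dots> \<le> (\<Sum>i. emeasure lborel (cball (v i) (diameter (S i) / k)))"
      by (intro emeasure_subadditive_countably) auto
    also have "\<dots> = (\<Sum>i. ennreal ((2 / k) ^ ?d) * ennreal (?t (S i)))"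
      using k diam by (intro suminf_cong)
        (simp add: emeasure_cball ennreal_mult[symmetric] unit_ball_vol_nonneg power_divide power_mult_distrib field_simps)
    also have "\<dots> = ennreal ((2 / k) ^ ?d) * (\<Sum>i. ennreal (?t (S i)))"
      by (rule ennreal_suminf_cmult)
    finally have "ennreal ((k / 2) ^ ?d) * emeasure lborel B
        \<le> ennreal ((k / 2) ^ ?d) * (ennreal ((2 / k) ^ ?d) * (\<Sum>i. ennreal (?t (S i))))"
      by (rule mult_left_mono) auto
    also have "\<dots> = (\<Sum>i. ennreal (?t (S i)))"
      using k by (simp add: mult.assoc[symmetric] ennreal_mult[symmetric] power_mult_distrib[symmetric])
    finally show "ennreal ((k / 2) ^ ?d) * emeasure lborel B \<le> (\<Sum>i. ennreal (?t (S i)))" .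
  qed
  also have "\<dots> \<le> hausdorff ?d (\<phi> ` B)"
    unfolding hausdorff_def by (rule SUP_upper) auto
  finally show ?thesis .
qed

text \<open>The derivative is differentiable at \<open>u\<close>, hence satisfies a Lipschitz
  estimate against its value at \<open>u\<close>. The mean value inequality for
  \<open>\<phi>\<close> minus its linear part at \<open>u\<close> then gives every bound, since the
  injective linear part is bounded below by \<open>m\<close>.\<close>

lemma twice_diff_chart_bounds:
  fixes \<phi> :: "'b::euclidean_space \<Rightarrow> 'a::euclidean_space"
  assumes ch: "twice_diff_chart M W \<phi> U" and u: "u \<in> W"
  obtains r k L K \<phi>' where "r > 0" "k > 0" "L > 0" "K \<ge> 0" "ball u r \<subseteq> W"
    "(\<phi> has_derivative \<phi>') (at u)" "linear \<phi>'"
    "\<And>v w. v \<in> ball u r \<Longrightarrow> w \<in> ball u r \<Longrightarrow> k * dist v w \<le> dist (\<phi> v) (\<phi> w)"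
    "\<And>v w. v \<in> ball u r \<Longrightarrow> w \<in> ball u r \<Longrightarrow> dist (\<phi> v) (\<phi> w) \<le> L * dist v w"
    "\<And>v. v \<in> ball u r \<Longrightarrow> norm (\<phi> v - \<phi> u - \<phi>' (v - u)) \<le> K * (norm (v - u))\<^sup>2"
proof -
  from ch obtain D :: "'b \<Rightarrow> 'b \<Rightarrow>\<^sub>L 'a" where oW: "open W"
    and D: "\<And>v. v \<in> W \<Longrightarrow> (\<phi> has_derivative blinfun_apply (D v)) (at v)"
    and injD: "inj (blinfun_apply (D u))" and DD: "D differentiable (at u)"
    unfolding twice_diff_chart_def using u by blast
  let ?P = "blinfun_apply (D u)"
  have lin: "linear ?P" using blinfun.bounded_linear_right bounded_linear.linear by blast
  from DD obtain E where E: "(D has_derivative E) (at u)" by (auto simp: differentiable_def)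
  then have blE: "bounded_linear E" by (rule has_derivative_bounded_linear)
  obtain r1 where r1: "r1 > 0" "\<And>v. norm (v - u) < r1 \<Longrightarrow> norm (D v - D u - E (v - u)) \<le> norm (v - u)"
    using E unfolding has_derivative_at_alt by (metis mult_1 zero_less_one)
  define B where "B = onorm E + 1"
  have B: "B > 0" using onorm_pos_le[OF blE] by (simp add: B_def)
  have DB: "norm (D v - D u) \<le> B * norm (v - u)" if "norm (v - u) < r1" for v
  proof -
    have "norm (D v - D u) \<le> norm (D v - D u - E (v - u)) + norm (E (v - u))"
      by (metis diff_add_cancel norm_triangle_ineq)
    then show ?thesis using r1(2)[OF that] onorm[OF blE, of "v - u"] by (simp add: B_def algebra_simps)
  qed
  obtain r2 where r2: "r2 > 0" "ball u r2 \<subseteq> W" using oW u openE by blast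
  obtain m where m: "m > 0" "\<And>h. m * norm h \<le> norm (?P h)"
    using linear_inj_bounded_below_pos[OF lin injD] by blast
  \<comment> \<open>The last bound forces \<open>B * r \<le> m / 2\<close>: the nonlinear error
    takes at most half of the lower bound \<open>m\<close>.\<close>
  define r where "r = min (min r1 r2) (m / (2 * B))"
  have r: "r > 0" "r \<le> r1" "r \<le> r2" using r1 r2 m B by (auto simp: r_def)
  have "r \<le> m / (2 * B)" by (simp add: r_def)
  then have Br: "B * r \<le> m / 2" using B by (simp add: field_simps)
  \<comment> \<open>The radius \<open>s\<close> stays free: \<open>s = dist u v\<close> gives the
    quadratic remainder at \<open>u\<close>, the larger of the two distances gives the bi-Lipschitz
    bounds.\<close>
  have key: "norm (\<phi> v - \<phi> w - ?P (v - w)) \<le> B * s * norm (v - w)"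
    if "v \<in> cball u s" "w \<in> cball u s" "s < r" for v w s
  proof -
    have "norm ((\<phi> v - ?P v) - (\<phi> w - ?P w)) \<le> B * s * norm (v - w)"
    proof (rule differentiable_bound[of "cball u s" "\<lambda>v. \<phi> v - ?P v" "\<lambda>v h. D v h - ?P h"])
      fix x assume x: "x \<in> cball u s"
      then have xs: "norm (x - u) \<le> s" by (simp add: dist_norm norm_minus_commute)
      have "x \<in> W" using x that r r2 by (force simp: subset_iff)
      then show "((\<lambda>v. \<phi> v - ?P v) has_derivative (\<lambda>h. D x h - ?P h)) (at x within cball u s)"
        by (intro has_derivative_diff has_derivative_at_withinI[OF D] bounded_linear_imp_has_derivative)
           (auto simp: blinfun.bounded_linear_right)
      have "onorm (\<lambda>h. D x h - ?P h) = norm (D x - D u)"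
        by (simp add: norm_blinfun.rep_eq blinfun.diff_left[abs_def, symmetric])
      also have "\<dots> \<le> B * norm (x - u)" using xs that r by (intro DB) auto
      also have "\<dots> \<le> B * s" using xs B by (intro mult_left_mono) auto
      finally show "onorm (\<lambda>h. D x h - ?P h) \<le> B * s" .
    qed (use that in auto)
    then show ?thesis by (simp add: linear_diff[OF lin] algebra_simps)
  qed
  have key': "norm (\<phi> v - \<phi> w - ?P (v - w)) \<le> m / 2 * norm (v - w)"
    if "v \<in> ball u r" "w \<in> ball u r" for v w
  proof -
    define s where "s = max (dist u v) (dist u w)"
    have "norm (\<phi> v - \<phi> w - ?P (v - w)) \<le> B * s * norm (v - w)"
      using that by (intro key) (auto simp: s_def)
    also have "\<dots> \<le> m / 2 * norm (v - w)"
    proof (rule mult_right_mono)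
      have "B * s \<le> B * r" using that B by (intro mult_left_mono) (auto simp: s_def)
      then show "B * s \<le> m / 2" using Br by linarith
    qed auto
    finally show ?thesis .
  qed
  define L where "L = onorm ?P + m"
  have L: "L > 0" using onorm_pos_le[OF blinfun.bounded_linear_right[of "D u"]] m(1) by (simp add: L_def)
  show ?thesis
  proof (rule that[of r "m / 2" L B ?P])
    show "ball u r \<subseteq> W" using r r2 by (auto simp: subset_iff)
    show "(\<phi> has_derivative ?P) (at u)" using D u by auto
    fix v w assume vw: "v \<in> ball u r" "w \<in> ball u r"
    have "norm (?P (v - w)) \<le> norm (\<phi> v - \<phi> w) + norm (\<phi> v - \<phi> w - ?P (v - w))"
      by (metis norm_minus_commute norm_triangle_sub add.commute)
    then show "m / 2 * dist v w \<le> dist (\<phi> v) (\<phi> w)"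
      using key'[OF vw] m(2)[of "v - w"] by (simp add: dist_norm)
    have "norm (\<phi> v - \<phi> w) \<le> norm (?P (v - w)) + norm (\<phi> v - \<phi> w - ?P (v - w))"
      by (metis norm_triangle_sub)
    also have "\<dots> \<le> onorm ?P * norm (v - w) + m / 2 * norm (v - w)"
      using key'[OF vw] onorm[of ?P "v - w"] by (intro add_mono) (auto simp: blinfun.bounded_linear_right)
    also have "\<dots> \<le> L * norm (v - w)" using m by (simp add: L_def algebra_simps)
    finally show "dist (\<phi> v) (\<phi> w) \<le> L * dist v w" by (simp add: dist_norm)
  next
    fix v assume "v \<in> ball u r"
    then show "norm (\<phi> v - \<phi> u - ?P (v - u)) \<le> B * (norm (v - u))\<^sup>2"
      using key[of v "dist u v" u] by (simp add: dist_norm norm_minus_commute power2_eq_square mult.assoc)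
  qed (use r m L B lin in auto)
qed

text \<open>Continuity of the inverse chart excludes other sheets of \<open>M\<close> near
  \<open>\<phi> u\<close>; this is where embeddedness enters.\<close>

lemma twice_diff_chart_near:
  fixes \<phi> :: "'b::euclidean_space \<Rightarrow> 'a::euclidean_space"
  assumes ch: "twice_diff_chart M W \<phi> U" and u: "u \<in> W" and r: "r > 0"
  obtains \<rho> where "\<rho> > 0"
    "\<And>y. y \<in> M \<Longrightarrow> dist y (\<phi> u) < \<rho> \<Longrightarrow> \<exists>v\<in>ball u r. \<phi> v = y"
proof -
  let ?\<psi> = "inv_into W \<phi>"
  have U: "open U" and im: "\<phi> ` W = M \<inter> U" and inj: "inj_on \<phi> W" and c: "continuous_on (M \<inter> U) ?\<psi>"
    using ch by (auto simp: twice_diff_chart_def)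
  have x: "\<phi> u \<in> M \<inter> U" using im u by blast
  obtain \<rho>1 where 1: "\<rho>1 > 0" "ball (\<phi> u) \<rho>1 \<subseteq> U" using U x openE by blast
  obtain \<rho>2 where 2: "\<rho>2 > 0" "\<And>y. y \<in> M \<inter> U \<Longrightarrow> dist y (\<phi> u) < \<rho>2 \<Longrightarrow> dist (?\<psi> y) (?\<psi> (\<phi> u)) < r"
    using c x r unfolding continuous_on_iff by metis
  show ?thesis
  proof (rule that[of "min \<rho>1 \<rho>2"])
    fix y assume y: "y \<in> M" "dist y (\<phi> u) < min \<rho>1 \<rho>2"
    then have yU: "y \<in> M \<inter> U" using 1 by (auto simp: dist_commute)
    then have "\<phi> (?\<psi> y) = y" using im by (metis f_inv_into_f)
    moreover have "?\<psi> y \<in> ball u r"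
      using 2(2)[OF yU] y inv_into_f_f[OF inj u] by (simp add: dist_commute)
    ultimately show "\<exists>v\<in>ball u r. \<phi> v = y" by auto
  qed (use 1 2 in auto)
qed

text \<open>Lines in the chart give one inclusion. For the other, a curve in \<open>M\<close> is
  lifted to the chart: the lower Lipschitz bound makes the lift \<open>O(t)\<close>, so by the
  quadratic remainder the difference quotients of the curve approach the closed subspace
  \<open>range \<phi>'\<close>.\<close>

lemma tangent_space_chart:
  fixes \<phi> :: "'b::euclidean_space \<Rightarrow> 'a::euclidean_space"
  assumes ch: "twice_diff_chart M W \<phi> U" and u: "u \<in> W"
    and der: "(\<phi> has_derivative \<phi>') (at u)" and lin: "linear \<phi>'"
    and r: "r > 0" and k: "k > 0" and rW: "ball u r \<subseteq> W"
    and inv: "\<And>v w. v \<in> ball u r \<Longrightarrow> w \<in> ball u r \<Longrightarrow> k * dist v w \<le> dist (\<phi> v) (\<phi> w)"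
    and quad: "\<And>v. v \<in> ball u r \<Longrightarrow> norm (\<phi> v - \<phi> u - \<phi>' (v - u)) \<le> K * (norm (v - u))\<^sup>2"
    and K: "K \<ge> 0"
  shows "tangent_space M (\<phi> u) = range \<phi>'"
proof
  show "range \<phi>' \<subseteq> tangent_space M (\<phi> u)"
  proof
    fix v assume "v \<in> range \<phi>'"
    then obtain h where h: "v = \<phi>' h" by auto
    define e where "e = r / (norm h + 1)"
    have nh: "norm h + 1 > 0" by (smt (verit) norm_ge_zero)
    have e: "e > 0" using r nh by (simp add: e_def)
    have im: "\<phi> ` W = M \<inter> U" using ch by (auto simp: twice_diff_chart_def)
    have "\<phi> (u + t *\<^sub>R h) \<in> M" if "t \<in> {-e<..<e}" for t
    proof -
      have "\<bar>t\<bar> * norm h \<le> \<bar>t\<bar> * (norm h + 1)" by (intro mult_left_mono) auto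
      also have "\<dots> < e * (norm h + 1)" using that nh by (intro mult_strict_right_mono) auto
      also have "\<dots> = r" using nh by (simp add: e_def)
      finally have "u + t *\<^sub>R h \<in> ball u r" by (simp add: dist_norm)
      then show ?thesis using rW im by blast
    qed
    moreover have "((\<lambda>t. \<phi> (u + t *\<^sub>R h)) has_vector_derivative v) (at 0)"
      unfolding has_vector_derivative_def h linear_scale[OF lin, symmetric]
      by (rule has_derivative_compose[where f="\<lambda>t. u + t *\<^sub>R h" and f'="\<lambda>t. t *\<^sub>R h"])
         (auto intro!: derivative_eq_intros der)
    ultimately show "v \<in> tangent_space M (\<phi> u)"
      unfolding tangent_space_def using e by (auto intro!: exI[of _ "\<lambda>t. \<phi> (u + t *\<^sub>R h)"] exI[of _ e])
  qed
next
  show "tangent_space M (\<phi> u) \<subseteq> range \<phi>'"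
  proof
    fix v assume "v \<in> tangent_space M (\<phi> u)"
    then obtain \<gamma> e where e: "e > 0" and \<gamma>M: "\<And>t. t \<in> {-e<..<e} \<Longrightarrow> \<gamma> t \<in> M" and \<gamma>0: "\<gamma> 0 = \<phi> u"
      and \<gamma>d: "(\<gamma> has_vector_derivative v) (at 0)"
      unfolding tangent_space_def by blast
    obtain \<rho> where \<rho>: "\<rho> > 0" "\<And>y. y \<in> M \<Longrightarrow> dist y (\<phi> u) < \<rho> \<Longrightarrow> \<exists>v\<in>ball u r. \<phi> v = y"
      using twice_diff_chart_near[OF ch u r] by metis
    have \<gamma>c: "(\<gamma> \<longlongrightarrow> \<phi> u) (at 0)"
      using has_vector_derivative_continuous[OF \<gamma>d] \<gamma>0 by (simp add: continuous_at isCont_def)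
    have ev: "\<forall>\<^sub>F t in at 0. \<exists>c\<in>ball u r. \<phi> c = \<gamma> t"
    proof -
      have "\<forall>\<^sub>F t in at 0. dist (\<gamma> t) (\<phi> u) < \<rho>" using \<gamma>c \<rho>(1) by (rule tendstoD)
      moreover have "\<forall>\<^sub>F t in at (0::real). t \<in> {-e<..<e}"
        using e by (intro eventually_at_in_open') auto
      ultimately show ?thesis
        by eventually_elim (use \<rho> \<gamma>M in auto)
    qed
    \<comment> \<open>The lift is chosen pointwise; neither continuity nor differentiability of
      \<open>c\<close> is used, only the size of \<open>c t - u\<close>.\<close>
    define c where "c t = (SOME c. c \<in> ball u r \<and> \<phi> c = \<gamma> t)" for t
    have evc: "\<forall>\<^sub>F t in at 0. c t \<in> ball u r \<and> \<phi> (c t) = \<gamma> t"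
      using ev
    proof eventually_elim
      fix t assume "\<exists>c\<in>ball u r. \<phi> c = \<gamma> t"
      then have "\<exists>c. c \<in> ball u r \<and> \<phi> c = \<gamma> t" by blast
      then show "c t \<in> ball u r \<and> \<phi> (c t) = \<gamma> t"
        unfolding c_def by (rule someI_ex)
    qed
    define q where "q t = (\<gamma> t - \<phi> u) /\<^sub>R t" for t
    have q: "(q \<longlongrightarrow> v) (at 0)"
    proof (rule LIM_zero_cancel, rule tendsto_norm_zero_cancel)
      have "((\<lambda>t. norm (\<gamma> t - \<phi> u - t *\<^sub>R v) / \<bar>t\<bar>) \<longlongrightarrow> 0) (at 0)"
        using \<gamma>d \<gamma>0 unfolding has_vector_derivative_def has_derivative_iff_norm by simp
      then show "((\<lambda>t. norm (q t - v)) \<longlongrightarrow> 0) (at 0)"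
      proof (rule Lim_transform_eventually)
        show "\<forall>\<^sub>F t in at 0. norm (\<gamma> t - \<phi> u - t *\<^sub>R v) / \<bar>t\<bar> = norm (q t - v)"
          using eventually_neq_at_within[of 0 0 UNIV]
        proof eventually_elim
          fix t :: real assume "t \<noteq> 0"
          then have "q t - v = (\<gamma> t - \<phi> u - t *\<^sub>R v) /\<^sub>R t"
            by (simp add: q_def scaleR_diff_right)
          then show "norm (\<gamma> t - \<phi> u - t *\<^sub>R v) / \<bar>t\<bar> = norm (q t - v)"
            by (simp add: divide_inverse_commute)
        qed
      qed
    qed
    define w where "w t = \<phi>' ((c t - u) /\<^sub>R t)" for t
    have "((\<lambda>t. q t - w t) \<longlongrightarrow> 0) (at 0)"
    proof (rule Lim_null_comparison)
      show "\<forall>\<^sub>F t in at 0. norm (q t - w t) \<le> K / k\<^sup>2 * (norm (q t) * norm (\<gamma> t - \<phi> u))"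
        using evc eventually_neq_at_within[of 0 0 UNIV]
      proof eventually_elim
        fix t :: real assume ct: "c t \<in> ball u r \<and> \<phi> (c t) = \<gamma> t" and t: "t \<noteq> 0"
        have "q t - w t = (\<phi> (c t) - \<phi> u - \<phi>' (c t - u)) /\<^sub>R t"
          using ct by (simp add: q_def w_def linear_scale[OF lin] linear_diff[OF lin] scaleR_diff_right)
        then have "norm (q t - w t) = norm (\<phi> (c t) - \<phi> u - \<phi>' (c t - u)) / \<bar>t\<bar>"
          by (simp add: divide_inverse_commute)
        also have "\<dots> \<le> K * (norm (c t - u))\<^sup>2 / \<bar>t\<bar>"
          using quad[of "c t"] ct by (intro divide_right_mono) auto
        also have "\<dots> \<le> K * (norm (\<gamma> t - \<phi> u) / k)\<^sup>2 / \<bar>t\<bar>"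
        proof (intro divide_right_mono mult_left_mono power_mono)
          show "norm (c t - u) \<le> norm (\<gamma> t - \<phi> u) / k"
            using inv[of "c t" u] ct r k by (simp add: dist_norm field_simps)
        qed (use K in auto)
        also have "\<dots> = K / k\<^sup>2 * (norm (q t) * norm (\<gamma> t - \<phi> u))"
        proof -
          have "norm (q t) = norm (\<gamma> t - \<phi> u) / \<bar>t\<bar>" by (simp add: q_def divide_inverse_commute)
          then show ?thesis by (simp add: power2_eq_square field_simps)
        qed
        finally show "norm (q t - w t) \<le> K / k\<^sup>2 * (norm (q t) * norm (\<gamma> t - \<phi> u))" .
      qed
      have "((\<lambda>t. K / k\<^sup>2 * (norm (q t) * norm (\<gamma> t - \<phi> u))) \<longlongrightarrow> K / k\<^sup>2 * (norm v * norm (\<phi> u - \<phi> u))) (at 0)"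
        by (intro tendsto_intros q \<gamma>c)
      then show "((\<lambda>t. K / k\<^sup>2 * (norm (q t) * norm (\<gamma> t - \<phi> u))) \<longlongrightarrow> 0) (at 0)" by simp
    qed
    from tendsto_diff[OF q this] have "(w \<longlongrightarrow> v) (at 0)" by simp
    moreover have "closed (range \<phi>')"
      using lin by (intro closed_subspace linear_subspace_image) auto
    ultimately show "v \<in> range \<phi>'"
      by (intro Lim_in_closed_set[of "range \<phi>'" w "at (0::real)"]) (auto simp: w_def)
  qed
qed

lemma twice_diff_submanifold_chart:
  fixes M :: "'a::euclidean_space set"
  assumes "twice_diff_submanifold M TYPE('b::euclidean_space)" and "x \<in> M"
  obtains W :: "'b::euclidean_space set" and \<phi> U u where "twice_diff_chart M W \<phi> U" "u \<in> W" "\<phi> u = x"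
proof -
  obtain W :: "'b set" and \<phi> U where x: "x \<in> U" and ch: "twice_diff_chart M W \<phi> U"
    using assms unfolding twice_diff_submanifold_def by blast
  then have "x \<in> \<phi> ` W" using assms(2) by (simp add: twice_diff_chart_def)
  then show ?thesis using that ch by blast
qed

lemma subspace_tangent_space:
  fixes M :: "'a::euclidean_space set"
  assumes "twice_diff_submanifold M TYPE('b::euclidean_space)" and "x \<in> M"
  shows "subspace (tangent_space M x)"
proof -
  obtain W :: "'b set" and \<phi> U u where ch: "twice_diff_chart M W \<phi> U" and u: "u \<in> W" "\<phi> u = x"
    using twice_diff_submanifold_chart[OF assms] by metis
  show ?thesis
    using twice_diff_chart_bounds[OF ch u(1)] tangent_space_chart[OF ch u(1)] u(2)
    by (smt (verit) linear_subspace_image subspace_UNIV)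
qed

text \<open>The linear part of the chart is tangent, hence orthogonal to \<open>n\<close>, and only
  the quadratic remainder survives. The constants depend on \<open>x\<close> but not on
  \<open>n\<close>.\<close>

lemma normal_quadratic_local:
  fixes M :: "'a::euclidean_space set"
  assumes "twice_diff_submanifold M TYPE('b::euclidean_space)" and "x \<in> M"
  obtains \<rho> K where "\<rho> > 0" "K \<ge> 0"
    "\<And>y n. y \<in> M \<Longrightarrow> dist y x < \<rho> \<Longrightarrow> (\<And>t. t \<in> tangent_space M x \<Longrightarrow> n \<bullet> t = 0) \<Longrightarrow> norm n = 1
      \<Longrightarrow> (y - x) \<bullet> n \<le> K * (norm (y - x))\<^sup>2"
proof -
  obtain W :: "'b set" and \<phi> U u where ch: "twice_diff_chart M W \<phi> U" and u: "u \<in> W" "\<phi> u = x"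
    using twice_diff_submanifold_chart[OF assms] by metis
  obtain r k L K \<phi>' where r: "r > 0" "k > 0" "K \<ge> 0" "ball u r \<subseteq> W"
    "(\<phi> has_derivative \<phi>') (at u)" "linear \<phi>'"
    and inv: "\<And>v w. v \<in> ball u r \<Longrightarrow> w \<in> ball u r \<Longrightarrow> k * dist v w \<le> dist (\<phi> v) (\<phi> w)"
    and quad: "\<And>v. v \<in> ball u r \<Longrightarrow> norm (\<phi> v - \<phi> u - \<phi>' (v - u)) \<le> K * (norm (v - u))\<^sup>2"
    using twice_diff_chart_bounds[OF ch u(1)] by metis
  have T: "tangent_space M x = range \<phi>'"
    using tangent_space_chart[OF ch u(1) r(5,6,1,2,4) inv quad r(3)] u by auto
  obtain \<rho> where \<rho>: "\<rho> > 0" "\<And>y. y \<in> M \<Longrightarrow> dist y (\<phi> u) < \<rho> \<Longrightarrow> \<exists>v\<in>ball u r. \<phi> v = y"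
    using twice_diff_chart_near[OF ch u(1) r(1)] by metis
  show ?thesis
  proof (rule that[of \<rho> "K / k\<^sup>2"])
    fix y n assume y: "y \<in> M" "dist y x < \<rho>" and n: "\<And>t. t \<in> tangent_space M x \<Longrightarrow> n \<bullet> t = 0" "norm n = 1"
    obtain v where v: "v \<in> ball u r" "\<phi> v = y" using \<rho>(2)[of y] y u by auto
    have "n \<bullet> \<phi>' (v - u) = 0" by (rule n) (simp add: T)
    then have "(y - x) \<bullet> n = (\<phi> v - \<phi> u - \<phi>' (v - u)) \<bullet> n"
      using v u by (simp add: inner_diff_left inner_commute[of "\<phi>' (v - u)"])
    also have "\<dots> \<le> norm (\<phi> v - \<phi> u - \<phi>' (v - u))"
      using norm_cauchy_schwarz[of "\<phi> v - \<phi> u - \<phi>' (v - u)" n] n by simp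
    also have "\<dots> \<le> K * (norm (v - u))\<^sup>2" by (rule quad[OF v(1)])
    also have "\<dots> \<le> K * (norm (y - x) / k)\<^sup>2"
      using inv[of v u] v u r by (intro mult_left_mono power_mono) (auto simp: dist_norm field_simps)
    finally show "(y - x) \<bullet> n \<le> K / k\<^sup>2 * (norm (y - x))\<^sup>2" by (simp add: power_divide)
  qed (use r \<rho> in auto)
qed

text \<open>The ball of radius \<open>s / L\<close> about the preimage of \<open>p\<close> is mapped
  into \<open>ball p s\<close>, and its image has measure of order \<open>s ^ d\<close>. Preimages
  within \<open>r / 2\<close> of \<open>u\<close> and \<open>s / L < r / 2\<close> keep that ball
  inside the chart domain for all \<open>p\<close> near \<open>x\<close>.\<close>

lemma hausdorff_ball_local:
  fixes M :: "'a::euclidean_space set"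
  assumes "twice_diff_submanifold M TYPE('b::euclidean_space)" and "x \<in> M"
  obtains \<epsilon> m where "\<epsilon> > 0" "m > 0"
    "\<And>p s. p \<in> M \<Longrightarrow> dist p x < \<epsilon> \<Longrightarrow> 0 < s \<Longrightarrow> s < \<epsilon> \<Longrightarrow>
      ennreal (m * s ^ DIM('b)) \<le> hausdorff DIM('b) (M \<inter> ball p s)"
proof -
  obtain W :: "'b set" and \<phi> U u where ch: "twice_diff_chart M W \<phi> U" and u: "u \<in> W" "\<phi> u = x"
    using twice_diff_submanifold_chart[OF assms] by metis
  obtain r k L K \<phi>' where r: "r > 0" "k > 0" "L > 0" "ball u r \<subseteq> W"
    and inv: "\<And>v w. v \<in> ball u r \<Longrightarrow> w \<in> ball u r \<Longrightarrow> k * dist v w \<le> dist (\<phi> v) (\<phi> w)"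
    and lip: "\<And>v w. v \<in> ball u r \<Longrightarrow> w \<in> ball u r \<Longrightarrow> dist (\<phi> v) (\<phi> w) \<le> L * dist v w"
    using twice_diff_chart_bounds[OF ch u(1)] by metis
  obtain \<rho> where \<rho>: "\<rho> > 0" "\<And>y. y \<in> M \<Longrightarrow> dist y (\<phi> u) < \<rho> \<Longrightarrow> \<exists>v\<in>ball u (r / 2). \<phi> v = y"
    using twice_diff_chart_near[OF ch u(1), of "r / 2"] r by auto
  have im: "\<phi> ` W = M \<inter> U" using ch by (auto simp: twice_diff_chart_def)
  let ?m = "(k / 2) ^ DIM('b) * (unit_ball_vol (real DIM('b)) * (1 / L) ^ DIM('b))"
  show ?thesis
  proof (rule that[of "min \<rho> (L * r / 2)" ?m])
    fix p s assume p: "p \<in> M" "dist p x < min \<rho> (L * r / 2)" and s: "0 < s" "s < min \<rho> (L * r / 2)"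
    obtain v where v: "v \<in> ball u (r / 2)" "\<phi> v = p" using \<rho>(2)[of p] p u by auto
    define B where "B = ball v (s / L)"
    have Bu: "B \<subseteq> ball u r"
    proof
      fix w assume "w \<in> B"
      then have "dist v w < s / L" by (simp add: B_def)
      also have "\<dots> < r / 2" using s r by (simp add: field_simps)
      finally have "dist v w < r / 2" .
      then show "w \<in> ball u r" using v dist_triangle[of u w v] by simp
    qed
    have "\<phi> ` B \<subseteq> M \<inter> ball p s"
    proof
      fix y assume "y \<in> \<phi> ` B"
      then obtain w where w: "w \<in> B" "y = \<phi> w" by auto
      have "dist p y \<le> L * dist v w" using lip[of v w] v w Bu r by force
      also have "\<dots> < s" using w r by (simp add: B_def field_simps)
      finally show "y \<in> M \<inter> ball p s" using w Bu r im by auto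
    qed
    then have "hausdorff DIM('b) (\<phi> ` B) \<le> hausdorff DIM('b) (M \<inter> ball p s)" by (rule hausdorff_mono)
    moreover have "ennreal ((k / 2) ^ DIM('b)) * emeasure lborel B \<le> hausdorff DIM('b) (\<phi> ` B)"
      using Bu r by (intro hausdorff_ge_lipschitz_inverse inv) auto
    moreover have "ennreal ((k / 2) ^ DIM('b)) * emeasure lborel B = ennreal (?m * s ^ DIM('b))"
      using s r by (simp add: B_def emeasure_ball ennreal_mult[symmetric] power_divide mult.assoc)
    ultimately show "ennreal (?m * s ^ DIM('b)) \<le> hausdorff DIM('b) (M \<inter> ball p s)" by simp
  qed (use r \<rho> in auto)
qed

text \<open>A finite subcover of \<open>M\<close> allows the minimum of the local constants to be
  taken.\<close>

lemma hausdorff_ball_uniform: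
  fixes M :: "'a::euclidean_space set"
  assumes sub: "twice_diff_submanifold M TYPE('b::euclidean_space)" and "compact M"
  obtains \<epsilon> m where "\<epsilon> > 0" "m > 0"
    "\<And>p s. p \<in> M \<Longrightarrow> 0 < s \<Longrightarrow> s < \<epsilon> \<Longrightarrow>
      ennreal (m * s ^ DIM('b)) \<le> hausdorff DIM('b) (M \<inter> ball p s)"
proof -
  have "\<exists>\<epsilon>>0. \<exists>m>0. \<forall>p s. p \<in> M \<longrightarrow> dist p x < \<epsilon> \<longrightarrow> 0 < s \<longrightarrow> s < \<epsilon> \<longrightarrow>
      ennreal (m * s ^ DIM('b)) \<le> hausdorff DIM('b) (M \<inter> ball p s)" if "x \<in> M" for x
    using hausdorff_ball_local[OF sub that] by metis
  then obtain e m where e: "\<And>x. x \<in> M \<Longrightarrow> e x > 0" and m: "\<And>x. x \<in> M \<Longrightarrow> m x > (0::real)"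
    and loc: "\<And>x p s. x \<in> M \<Longrightarrow> p \<in> M \<Longrightarrow> dist p x < e x \<Longrightarrow> 0 < s \<Longrightarrow> s < e x \<Longrightarrow>
      ennreal (m x * s ^ DIM('b)) \<le> hausdorff DIM('b) (M \<inter> ball p s)"
    by metis
  have "M \<subseteq> (\<Union>x\<in>M. ball x (e x))" using e by force
  then obtain F where F: "F \<subseteq> M" "finite F" "M \<subseteq> (\<Union>x\<in>F. ball x (e x))"
    using compactE_image[OF \<open>compact M\<close>, of M "\<lambda>x. ball x (e x)"] by auto
  define \<epsilon> where "\<epsilon> = Min (insert 1 (e ` F))"
  define \<mu> where "\<mu> = Min (insert 1 (m ` F))"
  show ?thesis
  proof (rule that[of \<epsilon> \<mu>])
    show "\<epsilon> > 0" "\<mu> > 0" using F e m by (auto simp: \<epsilon>_def \<mu>_def subset_iff)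
    fix p s assume p: "p \<in> M" and s: "0 < s" "s < \<epsilon>"
    then obtain x where x: "x \<in> F" "dist p x < e x" using F by (auto simp: dist_commute)
    have "\<epsilon> \<le> e x" "\<mu> \<le> m x" using x F by (auto simp: \<epsilon>_def \<mu>_def)
    then have "ennreal (\<mu> * s ^ DIM('b)) \<le> ennreal (m x * s ^ DIM('b))"
      using s by (intro ennreal_leI mult_right_mono) auto
    also have "\<dots> \<le> hausdorff DIM('b) (M \<inter> ball p s)"
      using x F p s \<open>\<epsilon> \<le> e x\<close> by (intro loc) auto
    finally show "ennreal (\<mu> * s ^ DIM('b)) \<le> hausdorff DIM('b) (M \<inter> ball p s)" .
  qed
qed

subsection \<open>Positive reach\<close>

lemma compact_nearest_exists:
  fixes M :: "'a::heine_borel set"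
  assumes "compact M" "M \<noteq> {}"
  obtains p where "p \<in> M" "dist z p = infdist z M"
  using infdist_attains_inf[of M z] assms compact_imp_closed by metis

lemma nearest:
  fixes M :: "'a::heine_borel set"
  assumes "compact M" "M \<noteq> {}"
  shows "nearest M z \<in> M" "dist z (nearest M z) = infdist z M"
  using someI_ex[of "\<lambda>p. p \<in> M \<and> dist z p = infdist z M"] compact_nearest_exists[OF assms, of z]
  unfolding nearest_def by metis+

text \<open>Brouwer's fixed point theorem replaces the differential equation of Federer's argument: the
  fixed point of \<open>y \<mapsto> z + \<epsilon> (z - \<pi> y) / |z - \<pi> y|\<close> is a point \<open>y\<close> at distance \<open>\<epsilon>\<close> from \<open>z\<close> such that
  \<open>z\<close> lies on the segment from \<open>y\<close> to its nearest point.\<close>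

lemma normal_segment_extend:
  fixes M :: "'a::euclidean_space set"
  assumes M: "compact M" "M \<noteq> {}"
    and uniq: "\<And>z. infdist z M < \<tau> \<Longrightarrow> \<exists>!p. p \<in> M \<and> dist z p = infdist z M"
    and p: "p \<in> M" and n: "norm n = 1" and S: "0 < S" "infdist (p + S *\<^sub>R n) M = S"
    and \<epsilon>: "0 < \<epsilon>" "S + \<epsilon> < \<tau>"
  shows "infdist (p + (S + \<epsilon>) *\<^sub>R n) M = S + \<epsilon>"
proof -
  define z where "z = p + S *\<^sub>R n"
  have zp: "dist z p = S" using n S by (simp add: z_def dist_norm)
  have near: "infdist y M \<le> S + dist y z" for y
    using infdist_triangle[of y M z] S by (simp add: z_def)
  let ?\<pi> = "nearest M"
  \<comment> \<open>A map into the compact set \<open>M\<close> is continuous once its graph is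
    closed. Uniqueness of nearest points, valid on this ball as
    \<open>S + \<epsilon> < \<tau>\<close>, identifies the graph with a closed condition.\<close>
  have cont: "continuous_on (cball z \<epsilon>) ?\<pi>"
  proof (rule continuous_from_closed_graph)
    have eq: "(\<lambda>y. (y, ?\<pi> y)) ` cball z \<epsilon>
      = {q. fst q \<in> cball z \<epsilon> \<and> snd q \<in> M \<and> dist (fst q) (snd q) = infdist (fst q) M}" (is "_ = ?G")
    proof (intro equalityI subsetI)
      fix q assume "q \<in> ?G"
      then have q: "fst q \<in> cball z \<epsilon>" "snd q \<in> M" "dist (fst q) (snd q) = infdist (fst q) M" by auto
      have "infdist (fst q) M < \<tau>" using near[of "fst q"] q \<epsilon> by (simp add: dist_commute)
      from uniq[OF this] have "snd q = ?\<pi> (fst q)" using q nearest[OF M] by blast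
      then show "q \<in> (\<lambda>y. (y, ?\<pi> y)) ` cball z \<epsilon>" using q by (intro image_eqI[of _ _ "fst q"]) (auto simp: prod_eq_iff)
    qed (use nearest[OF M] in auto)
    have "closed ({q. fst q \<in> cball z \<epsilon>} \<inter> {q. snd q \<in> M} \<inter> {q. dist (fst q) (snd q) = infdist (fst q) M})"
      by (intro closed_Int closed_Collect_eq continuous_intros closed_vimage_snd[unfolded vimage_def]
          closed_vimage_fst[unfolded vimage_def] compact_imp_closed M closed_cball)
    moreover have "?G = {q. fst q \<in> cball z \<epsilon>} \<inter> {q. snd q \<in> M} \<inter> {q. dist (fst q) (snd q) = infdist (fst q) M}"
      by auto
    ultimately show "closed ((\<lambda>y. (y, ?\<pi> y)) ` cball z \<epsilon>)" unfolding eq by simp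
  qed (use M nearest[OF M] in auto)
  have far: "S \<le> dist z q" if "q \<in> M" for q
    using infdist_le[OF that, of z] S by (simp add: z_def)
  have nz: "z - ?\<pi> y \<noteq> 0" for y using far[OF nearest(1)[OF M, of y]] S by auto
  obtain y where y: "y \<in> cball z \<epsilon>" "z + (\<epsilon> / norm (z - ?\<pi> y)) *\<^sub>R (z - ?\<pi> y) = y"
  proof (rule brouwer[of "cball z \<epsilon>" "\<lambda>y. z + (\<epsilon> / norm (z - ?\<pi> y)) *\<^sub>R (z - ?\<pi> y)"])
    show "continuous_on (cball z \<epsilon>) (\<lambda>y. z + (\<epsilon> / norm (z - ?\<pi> y)) *\<^sub>R (z - ?\<pi> y))"
      using nz by (intro continuous_intros cont) auto
  qed (use \<epsilon> nz in \<open>auto simp: dist_norm\<close>)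
  define q where "q = ?\<pi> y"
  have q: "q \<in> M" "dist y q = infdist y M" using nearest[OF M] by (auto simp: q_def)
  define N where "N = norm (z - q)"
  have N: "N > 0" using nz[of y] by (simp add: N_def q_def)
  have yz: "y = z + (\<epsilon> / N) *\<^sub>R (z - q)" using y by (simp add: q_def N_def)
  have "y - q = (1 + \<epsilon> / N) *\<^sub>R (z - q)" by (simp add: yz algebra_simps)
  then have "dist y q = (1 + \<epsilon> / N) * N" using \<epsilon> N by (simp add: dist_norm N_def)
  then have yq: "dist y q = N + \<epsilon>" using N by (simp add: distrib_right)
  have "dist y z = \<epsilon>" using yz \<epsilon> N by (simp add: dist_norm N_def)
  \<comment> \<open>\<open>y\<close> has distance \<open>N + \<epsilon>\<close> to \<open>M\<close>,
    but at most \<open>S + \<epsilon>\<close> since it lies within \<open>\<epsilon>\<close> of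
    \<open>z\<close>. So \<open>q\<close> is also nearest to \<open>z\<close>, and uniqueness gives
    \<open>q = p\<close>.\<close>
  then have "N \<le> S" using near[of y] q yq by simp
  then have NS: "dist z q = S" using far[OF q(1)] by (simp add: N_def dist_norm)
  have "infdist z M = S" "infdist z M < \<tau>" using S \<epsilon> by (simp_all add: z_def)
  then have "q = p" using uniq[of z] NS zp p q by metis
  then have "y = p + (S + \<epsilon>) *\<^sub>R n"
    using NS S yz by (simp add: z_def N_def dist_norm algebra_simps)
  moreover have "infdist y M = S + \<epsilon>" using q(2) yq NS by (simp add: N_def dist_norm)
  ultimately show ?thesis by simp
qed

lemma infdist_eq_iff_ball:
  assumes "M \<noteq> {}" "p \<in> M" "norm n = 1" "0 \<le> s"
  shows "infdist (p + s *\<^sub>R n) M = s \<longleftrightarrow> (\<forall>x\<in>M. s \<le> dist (p + s *\<^sub>R n) x)"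
proof
  assume "infdist (p + s *\<^sub>R n) M = s"
  then show "\<forall>x\<in>M. s \<le> dist (p + s *\<^sub>R n) x" using infdist_le by metis
next
  assume *: "\<forall>x\<in>M. s \<le> dist (p + s *\<^sub>R n) x"
  have "infdist (p + s *\<^sub>R n) M \<le> dist (p + s *\<^sub>R n) p" by (rule infdist_le[OF assms(2)])
  also have "\<dots> = s" using assms by (simp add: dist_norm)
  finally have "infdist (p + s *\<^sub>R n) M \<le> s" .
  moreover have "s \<le> infdist (p + s *\<^sub>R n) M"
    unfolding infdist_notempty[OF assms(1)] using * assms(1) by (intro cINF_greatest) auto
  ultimately show "infdist (p + s *\<^sub>R n) M = s" by simp
qed

lemma dist_normal_sq:
  fixes p x n :: "'a::real_inner"
  assumes "norm n = 1"
  shows "(dist (p + s *\<^sub>R n) x)\<^sup>2 = (norm (x - p))\<^sup>2 - 2 * s * ((x - p) \<bullet> n) + s\<^sup>2"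
proof -
  have "n \<bullet> n = 1" using assms by (simp add: dot_square_norm)
  then show ?thesis
    unfolding dist_norm power2_norm_eq_inner
    by (simp add: inner_diff_left inner_diff_right inner_add_left
        inner_add_right inner_commute power2_eq_square algebra_simps)
qed

text \<open>The local quadratic bound makes a small ball touch \<open>M\<close> at \<open>p\<close>;
  \<open>normal_segment_extend\<close> moves its centre along the normal, and a largest admissible
  radius below \<open>t\<close> would contradict this extension.\<close>

lemma normal_ball_touches:
  fixes M :: "'a::euclidean_space set"
  assumes sub: "twice_diff_submanifold M TYPE('b::euclidean_space)"
    and M: "compact M" "M \<noteq> {}"
    and uniq: "\<And>z. infdist z M < \<tau> \<Longrightarrow> \<exists>!p. p \<in> M \<and> dist z p = infdist z M"
    and p: "p \<in> M" and n: "norm n = 1" "\<And>t. t \<in> tangent_space M p \<Longrightarrow> n \<bullet> t = 0"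
    and t: "0 < t" "t < \<tau>"
  shows "infdist (p + t *\<^sub>R n) M = t"
proof -
  obtain \<rho> K where \<rho>: "\<rho> > 0" and K: "K \<ge> 0"
    and quad: "\<And>y. y \<in> M \<Longrightarrow> dist y p < \<rho> \<Longrightarrow> (y - p) \<bullet> n \<le> K * (norm (y - p))\<^sup>2"
    using normal_quadratic_local[OF sub p] n by metis
  \<comment> \<open>Points of \<open>M\<close> near \<open>p\<close> are handled by
    \<open>2 * s * K \<le> 1\<close>, the remaining ones by \<open>s \<le> \<rho> / 2\<close> and
    the triangle inequality; \<open>K + 1\<close> covers the case \<open>K = 0\<close>.\<close>
  define s where "s = min t (min (\<rho> / 2) (1 / (2 * (K + 1))))"
  have s: "0 < s" "s \<le> t" "s \<le> \<rho> / 2" using t \<rho> K by (auto simp: s_def)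
  have "s \<le> 1 / (2 * (K + 1))" by (simp add: s_def)
  then have sK: "2 * s * K \<le> 1" using K s(1) by (simp add: field_simps)
  have start: "infdist (p + s *\<^sub>R n) M = s"
    unfolding infdist_eq_iff_ball[OF M(2) p n(1) less_imp_le[OF s(1)]]
  proof
    fix x assume x: "x \<in> M"
    show "s \<le> dist (p + s *\<^sub>R n) x"
    proof (cases "dist x p < \<rho>")
      case True
      have "2 * s * ((x - p) \<bullet> n) \<le> 2 * s * (K * (norm (x - p))\<^sup>2)"
        using quad[OF x True] s by (intro mult_left_mono) auto
      also have "\<dots> = (2 * s * K) * (norm (x - p))\<^sup>2" by simp
      also have "\<dots> \<le> 1 * (norm (x - p))\<^sup>2" by (intro mult_right_mono sK) auto
      finally have "s\<^sup>2 \<le> (dist (p + s *\<^sub>R n) x)\<^sup>2" unfolding dist_normal_sq[OF n(1)] by simp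
      then show ?thesis by (rule power2_le_imp_le) simp
    next
      case False
      have "dist x p \<le> dist (p + s *\<^sub>R n) x + dist (p + s *\<^sub>R n) p" by (metis dist_commute dist_triangle)
      then show ?thesis using False s n(1) by (simp add: dist_norm)
    qed
  qed
  define J where "J = {0..t} \<inter> {r. infdist (p + r *\<^sub>R n) M = r}"
  have "closed {r. infdist (p + r *\<^sub>R n) M = r}"
    by (intro closed_Collect_eq continuous_intros)
  then have "compact J" unfolding J_def by (intro compact_Int_closed) auto
  moreover have "s \<in> J" using start s by (simp add: J_def)
  ultimately obtain S where S: "S \<in> J" "\<And>r. r \<in> J \<Longrightarrow> r \<le> S"
    using compact_attains_sup[of J] by blast
  have "S = t"
  proof (rule ccontr)
    assume "S \<noteq> t"
    then have St: "S < t" using S by (simp add: J_def)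
    have "0 < S" using S(2)[OF \<open>s \<in> J\<close>] s by simp
    then have "infdist (p + (S + (t - S)) *\<^sub>R n) M = S + (t - S)"
      using S(1) St t by (intro normal_segment_extend[OF M uniq p n(1)]) (auto simp: J_def)
    then have "t \<in> J" using t by (simp add: J_def)
    then show False using S(2) St by force
  qed
  then show ?thesis using S by (simp add: J_def)
qed

text \<open>Federer's inequality: no point of \<open>M\<close> lies inside the ball of radius
  \<open>t\<close> about \<open>p + t *\<^sub>R n\<close>, and expanding the squared distance to
  that centre isolates the inner product.\<close>

lemma normal_component_le:
  fixes M :: "'a::euclidean_space set"
  assumes sub: "twice_diff_submanifold M TYPE('b::euclidean_space)"
    and M: "compact M" "M \<noteq> {}"
    and uniq: "\<And>z. infdist z M < \<tau> \<Longrightarrow> \<exists>!p. p \<in> M \<and> dist z p = infdist z M"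
    and p: "p \<in> M" and n: "norm n = 1" "\<And>t. t \<in> tangent_space M p \<Longrightarrow> n \<bullet> t = 0"
    and t: "0 < t" "t < \<tau>" and x: "x \<in> M"
  shows "(x - p) \<bullet> n \<le> (norm (x - p))\<^sup>2 / (2 * t)"
proof -
  have "t \<le> dist (p + t *\<^sub>R n) x"
    using normal_ball_touches[OF sub M uniq p n t] infdist_le[OF x] by metis
  then have "t\<^sup>2 \<le> (dist (p + t *\<^sub>R n) x)\<^sup>2" using t by (intro power_mono) auto
  then show ?thesis unfolding dist_normal_sq[OF n(1)] using t by (simp add: field_simps)
qed

text \<open>The reach is a supremum that need not be attained, hence the radius \<open>t\<close>
  strictly below \<open>\<tau>\<close>.\<close>

lemma reach_unique_nearest:
  assumes "\<tau> > 0" "reach M \<ge> ereal \<tau>" "t < \<tau>" "infdist z M < t"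
  shows "\<exists>!p. p \<in> M \<and> dist z p = infdist z M"
proof -
  have "ereal t < reach M" using assms by (meson ereal_less(2) less_ereal.simps(1) less_le_trans)
  then obtain r where "t < r" "\<forall>z. infdist z M < r \<longrightarrow> (\<exists>!p. p \<in> M \<and> dist z p = infdist z M)"
    unfolding reach_def less_Sup_iff by auto
  then show ?thesis using assms by auto
qed

section \<open>Orthogonal projection onto the tangent space\<close>

lemma tan_proj_unique:
  assumes T: "subspace (tangent_space M x)"
  shows "\<exists>!p. p \<in> tangent_space M x \<and> (\<forall>t\<in>tangent_space M x. (v - p) \<bullet> t = 0)"
proof -
  obtain y z where "y \<in> span (tangent_space M x)" "\<And>w. w \<in> span (tangent_space M x) \<Longrightarrow> orthogonal z w" "v = y + z"
    using orthogonal_subspace_decomp_exists[of "tangent_space M x" v] by metis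
  then have "y \<in> tangent_space M x \<and> (\<forall>t\<in>tangent_space M x. (v - y) \<bullet> t = 0)"
    using T by (simp add: span_eq_iff[THEN iffD2] orthogonal_def)
  moreover have "p = q" if "p \<in> tangent_space M x \<and> (\<forall>t\<in>tangent_space M x. (v - p) \<bullet> t = 0)"
      "q \<in> tangent_space M x \<and> (\<forall>t\<in>tangent_space M x. (v - q) \<bullet> t = 0)" for p q
  proof -
    have "p - q \<in> tangent_space M x" using that T by (auto intro: subspace_diff)
    then have "(v - p) \<bullet> (p - q) = 0" "(v - q) \<bullet> (p - q) = 0" using that by auto
    then have "(p - q) \<bullet> (p - q) = 0" by (simp add: inner_diff_left)
    then show "p = q" by simp
  qed
  ultimately show ?thesis by blast
qed

lemma tan_proj:
  assumes T: "subspace (tangent_space M x)"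
  shows "tan_proj M x v \<in> tangent_space M x"
    and "t \<in> tangent_space M x \<Longrightarrow> nor_proj M x v \<bullet> t = 0"
  using theI'[OF tan_proj_unique[OF T, of v]] by (auto simp: tan_proj_def nor_proj_def)

lemma tan_proj_eqI:
  assumes T: "subspace (tangent_space M x)"
    and "p \<in> tangent_space M x" "\<And>t. t \<in> tangent_space M x \<Longrightarrow> (v - p) \<bullet> t = 0"
  shows "tan_proj M x v = p"
  unfolding tan_proj_def using assms by (intro the1_equality tan_proj_unique) auto

lemma linear_tan_proj:
  assumes T: "subspace (tangent_space M x)"
  shows "linear (tan_proj M x)"
proof (rule linearI)
  fix v w
  have "(v + w - (tan_proj M x v + tan_proj M x w)) \<bullet> t = 0" if "t \<in> tangent_space M x" for t
    using tan_proj(2)[OF T that, of v] tan_proj(2)[OF T that, of w]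
    by (simp add: nor_proj_def inner_diff_left inner_add_left)
  then show "tan_proj M x (v + w) = tan_proj M x v + tan_proj M x w"
    using tan_proj(1)[OF T] T by (intro tan_proj_eqI) (auto intro: subspace_add)
next
  fix c v
  have "(c *\<^sub>R v - c *\<^sub>R tan_proj M x v) \<bullet> t = 0" if "t \<in> tangent_space M x" for t
    using tan_proj(2)[OF T that, of v] by (simp add: nor_proj_def inner_diff_left)
  then show "tan_proj M x (c *\<^sub>R v) = c *\<^sub>R tan_proj M x v"
    using tan_proj(1)[OF T] T by (intro tan_proj_eqI) (auto intro: subspace_scale)
qed

text \<open>Federer's inequality in the direction of the normal component itself, where the inner
  product becomes its norm.\<close>

lemma norm_nor_proj_le:
  fixes M :: "'a::euclidean_space set"
  assumes sub: "twice_diff_submanifold M TYPE('b::euclidean_space)"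
    and M: "compact M" "M \<noteq> {}"
    and uniq: "\<And>z. infdist z M < \<tau> \<Longrightarrow> \<exists>!p. p \<in> M \<and> dist z p = infdist z M"
    and p: "p \<in> M" and t: "0 < t" "t < \<tau>" and x: "x \<in> M"
  shows "norm (nor_proj M p (x - p)) \<le> (norm (x - p))\<^sup>2 / (2 * t)"
proof (cases "nor_proj M p (x - p) = 0")
  case True
  then show ?thesis using t by simp
next
  case False
  have T: "subspace (tangent_space M p)" by (rule subspace_tangent_space[OF sub p])
  let ?q = "nor_proj M p (x - p)"
  define n where "n = ?q /\<^sub>R norm ?q"
  have n: "norm n = 1" "\<And>t. t \<in> tangent_space M p \<Longrightarrow> n \<bullet> t = 0"
    using False tan_proj(2)[OF T] by (auto simp: n_def)
  have "(x - p) \<bullet> n = ?q \<bullet> n"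
    using n(2)[OF tan_proj(1)[OF T, of "x - p"]] by (simp add: nor_proj_def inner_diff_left inner_commute[of n])
  also have "\<dots> = norm ?q" using False by (simp add: n_def dot_square_norm power2_eq_square)
  finally show ?thesis using normal_component_le[OF sub M uniq p n t x] by simp
qed

text \<open>Along any curve in \<open>M\<close> through the nearest point, the squared distance to
  \<open>z\<close> is minimal there, so its derivative vanishes.\<close>

lemma nearest_diff_normal:
  fixes M :: "'a::euclidean_space set"
  assumes M: "compact M" "M \<noteq> {}" and T: "subspace (tangent_space M (nearest M z))"
  shows "tan_proj M (nearest M z) (z - nearest M z) = 0"
proof (rule tan_proj_eqI[OF T])
  let ?p = "nearest M z"
  fix v assume "v \<in> tangent_space M ?p"
  then obtain \<gamma> e where e: "e > 0" "\<forall>t\<in>{-e<..<e}. \<gamma> t \<in> M" "\<gamma> 0 = ?p"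
    and d: "(\<gamma> has_vector_derivative v) (at 0)" unfolding tangent_space_def by blast
  have "((\<lambda>t. (z - \<gamma> t) \<bullet> (z - \<gamma> t)) has_derivative
      (\<lambda>h. (z - \<gamma> 0) \<bullet> (0 - h *\<^sub>R v) + (0 - h *\<^sub>R v) \<bullet> (z - \<gamma> 0))) (at 0)"
    using d unfolding has_vector_derivative_def
    by (intro has_derivative_inner has_derivative_diff has_derivative_const)
  moreover have "(z - \<gamma> 0) \<bullet> (z - \<gamma> 0) \<le> (z - \<gamma> t) \<bullet> (z - \<gamma> t)" if "t \<in> {-e<..<e}" for t
  proof -
    have "dist z ?p \<le> dist z (\<gamma> t)" using nearest[OF M] infdist_le e that by metis
    then have "norm (z - \<gamma> 0) \<le> norm (z - \<gamma> t)" using e by (simp add: dist_norm)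
    then show ?thesis by (simp add: norm_le)
  qed
  ultimately have "(\<lambda>h. (z - \<gamma> 0) \<bullet> (0 - h *\<^sub>R v) + (0 - h *\<^sub>R v) \<bullet> (z - \<gamma> 0)) = (\<lambda>h. 0)"
    using e by (intro differential_zero_maxmin[of 0 "{-e<..<e}"]) auto
  from fun_cong[OF this, of 1] show "(z - ?p - 0) \<bullet> v = 0" using e by (simp add: inner_commute)
qed (use T subspace_0 in auto)

subsection \<open>Gaussian moments of a box\<close>

text \<open>Fubini on \<open>1\<^sub>B(x) 1\<^sub>A(f y)\<close> with \<open>B\<close> the unit ball: translating \<open>y\<close>, then \<open>x\<close>, then \<open>y\<close> again
  exchanges the roles of \<open>A\<close> and \<open>f -` A\<close>.\<close>

lemma lborel_distr_linear_isometry: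
  fixes f :: "'a::euclidean_space \<Rightarrow> 'a"
  assumes lin: "linear f" and iso: "\<And>x. norm (f x) = norm x"
  shows "distr lborel borel f = lborel"
proof (rule measure_eqI)
  have [measurable]: "f \<in> borel_measurable borel"
    using lin by (intro borel_measurable_continuous_onI linear_continuous_on) (simp add: linear_conv_bounded_linear)
  have "inj f" using lin iso by (metis linear_injective_0 norm_eq_zero)
  then have "surj f" using lin by (metis linear_injective_imp_surjective)
  \<comment> \<open>Translating \<open>y\<close> by \<open>g x\<close> turns \<open>f y\<close> into
    \<open>x + f y\<close>, so every translation of the target comes from one of the source.\<close>
  then obtain g where g: "\<And>x. f (g x) = x" by (metis surj_f_inv_f)
  fix A assume "A \<in> sets (distr lborel borel f)"
  then have [measurable]: "A \<in> sets borel" by simp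
  have tr: "(\<integral>\<^sup>+y. h (c + y) \<partial>lborel) = (\<integral>\<^sup>+y. h y \<partial>lborel)" if [measurable]: "h \<in> borel_measurable borel" for h and c :: 'a
    by (subst (2) lborel_distr_plus[symmetric, of c]) (simp add: nn_integral_distr)
  define a :: "'a \<Rightarrow> ennreal" where "a = indicator A"
  define b :: "'a \<Rightarrow> ennreal" where "b = indicator (ball 0 1)"
  have [measurable]: "a \<in> borel_measurable borel" "b \<in> borel_measurable borel" by (auto simp: a_def b_def intro!: borel_measurable_indicator)
  have bm: "b (- f y) = b y" for y using iso by (simp add: b_def indicator_def)
  have B: "(\<integral>\<^sup>+x. b x \<partial>lborel) = emeasure lborel (ball (0::'a) 1)" by (simp add: b_def)
  have "(\<integral>\<^sup>+x. b x \<partial>lborel) * emeasure (distr lborel borel f) A = (\<integral>\<^sup>+x. b x * (\<integral>\<^sup>+y. a (f y) \<partial>lborel) \<partial>lborel)"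
  proof -
    have "emeasure (distr lborel borel f) A = (\<integral>\<^sup>+y. a y \<partial>distr lborel borel f)"
      by (simp add: a_def)
    then show ?thesis by (simp add: nn_integral_distr nn_integral_multc)
  qed
  also have "\<dots> = (\<integral>\<^sup>+x. (\<integral>\<^sup>+y. b x * a (x + f y) \<partial>lborel) \<partial>lborel)"
  proof (rule nn_integral_cong)
    fix x
    have "(\<integral>\<^sup>+y. a (f y) \<partial>lborel) = (\<integral>\<^sup>+y. a (f (g x + y)) \<partial>lborel)"
      by (rule tr[symmetric]) simp
    then show "b x * (\<integral>\<^sup>+y. a (f y) \<partial>lborel) = (\<integral>\<^sup>+y. b x * a (x + f y) \<partial>lborel)"
      by (simp add: nn_integral_cmult linear_add[OF lin] g)
  qed
  also have "\<dots> = (\<integral>\<^sup>+y. (\<integral>\<^sup>+x. b x * a (x + f y) \<partial>lborel) \<partial>lborel)"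
    by (rule lborel_pair.Fubini') simp
  also have "\<dots> = (\<integral>\<^sup>+y. (\<integral>\<^sup>+x. b (x - f y) * a x \<partial>lborel) \<partial>lborel)"
  proof (rule nn_integral_cong)
    fix y
    show "(\<integral>\<^sup>+x. b x * a (x + f y) \<partial>lborel) = (\<integral>\<^sup>+x. b (x - f y) * a x \<partial>lborel)"
      by (subst tr[of "\<lambda>x. b (x - f y) * a x" "f y", symmetric]) (simp_all add: add.commute)
  qed
  also have "\<dots> = (\<integral>\<^sup>+x. (\<integral>\<^sup>+y. b (x - f y) * a x \<partial>lborel) \<partial>lborel)"
    by (rule lborel_pair.Fubini') simp
  also have "\<dots> = (\<integral>\<^sup>+x. (\<integral>\<^sup>+y. b y \<partial>lborel) * a x \<partial>lborel)"
  proof (rule nn_integral_cong)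
    fix x
    have "(\<integral>\<^sup>+y. b (x - f y) * a x \<partial>lborel) = (\<integral>\<^sup>+y. b (x - f (g x + y)) * a x \<partial>lborel)"
      by (rule tr[symmetric]) simp
    also have "\<dots> = (\<integral>\<^sup>+y. b y * a x \<partial>lborel)"
      by (simp add: linear_add[OF lin] g bm)
    finally show "(\<integral>\<^sup>+y. b (x - f y) * a x \<partial>lborel) = (\<integral>\<^sup>+y. b y \<partial>lborel) * a x"
      by (simp add: nn_integral_multc)
  qed
  also have "\<dots> = (\<integral>\<^sup>+x. b x \<partial>lborel) * emeasure lborel A"
    by (simp add: nn_integral_cmult a_def)
  finally show "emeasure (distr lborel borel f) A = emeasure lborel A"
    unfolding B using unit_ball_vol_pos[of "real DIM('a)"]
    by (simp add: ennreal_mult_cancel_left emeasure_ball less_imp_neq[symmetric])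
qed simp

section \<open>The Gaussian kernel\<close>

lemma gauss_eq:
  fixes v :: "'a::euclidean_space"
  shows "gauss \<sigma> v = gauss \<sigma> (0::'a) * exp (- (norm v)\<^sup>2 / (2 * \<sigma>\<^sup>2))"
  by (simp add: gauss_def)

lemma gauss_nonneg: "0 \<le> gauss \<sigma> v"
  by (simp add: gauss_def)

lemma abs_gauss [simp]: "\<bar>gauss \<sigma> v\<bar> = gauss \<sigma> v"
  by (simp add: gauss_nonneg)

lemma gauss_zero_pos: "\<sigma> > 0 \<Longrightarrow> 0 < gauss \<sigma> 0"
  by (simp add: gauss_def)

lemma gauss_antimono:
  fixes v w :: "'a::euclidean_space"
  shows "norm v \<le> norm w \<Longrightarrow> gauss \<sigma> w \<le> gauss \<sigma> v"
  by (auto simp: gauss_def intro!: divide_right_mono power_mono)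

lemma gauss_norm_cong:
  fixes v w :: "'a::euclidean_space"
  shows "norm v = norm w \<Longrightarrow> gauss \<sigma> v = gauss \<sigma> w"
  by (simp add: gauss_def)

lemma borel_measurable_gauss [measurable]: "gauss \<sigma> \<in> borel_measurable borel"
  unfolding gauss_def[abs_def] by measurable

lemma norm_gauss_scaleR_le:
  "gauss \<sigma> v \<le> a \<Longrightarrow> norm w \<le> b \<Longrightarrow> norm (gauss \<sigma> v *\<^sub>R w) \<le> a * b"
  using gauss_nonneg[of \<sigma> v] by (auto intro!: mult_mono)

lemma gauss_tail:
  fixes v :: "'a::euclidean_space"
  assumes "r / 2 \<le> norm v" "0 \<le> r"
  shows "gauss \<sigma> v \<le> gauss \<sigma> (0::'a) * exp (- r\<^sup>2 / (8 * \<sigma>\<^sup>2))"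
proof -
  have "(r / 2)\<^sup>2 \<le> (norm v)\<^sup>2" using assms by (intro power_mono) auto
  then have "- (norm v)\<^sup>2 / (2 * \<sigma>\<^sup>2) \<le> - (r / 2)\<^sup>2 / (2 * \<sigma>\<^sup>2)"
    by (intro divide_right_mono) auto
  also have "\<dots> = - r\<^sup>2 / (8 * \<sigma>\<^sup>2)" by (simp add: power_divide)
  finally show ?thesis unfolding gauss_eq[of \<sigma> v] by (intro mult_left_mono gauss_nonneg) simp
qed

section \<open>Reflection and moments on a box\<close>

text \<open>An abstract tangential projection, which separates the Gaussian estimates from the
  geometry of \<open>M\<close>. The two axioms already force \<open>A\<close> to be idempotent,
  hence the orthogonal projection onto its range.\<close>

locale orthogonal_splitting =
  fixes A :: "'a::euclidean_space \<Rightarrow> 'a"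
  assumes lin: "linear A" and orth: "A v \<bullet> (w - A w) = 0"
begin

definition Q :: "'a \<Rightarrow> 'a" where "Q v = v - A v"

definition box :: "'a \<Rightarrow> real \<Rightarrow> real \<Rightarrow> 'a set" where
  "box z r1 r2 = {w. norm (A (w - z)) \<le> r1 \<and> norm (Q (w - z)) \<le> r2}"

text \<open>The reflection across the range of \<open>A\<close>. As a linear isometry it preserves
  Lebesgue measure and the kernel, while it reverses the normal part.\<close>

definition flip :: "'a \<Rightarrow> 'a" where "flip v = A v - Q v"

lemma linear_Q: "linear Q"
  unfolding Q_def[abs_def] by (intro linear_compose_sub lin linear_id[unfolded id_def])

lemma A_A: "A (A v) = A v"
proof -
  have "A (A v) - A v = A (A v - v)" by (simp add: linear_diff[OF lin])
  then have "(A (A v) - A v) \<bullet> (A v - A (A v)) = 0" using orth[of "A v - v" "A v"] by simp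
  then show ?thesis by (metis inner_eq_zero_iff inner_minus_left minus_diff_eq neg_equal_0_iff_equal right_minus_eq)
qed

lemma A_Q: "A (Q v) = 0" and Q_A: "Q (A v) = 0" and Q_Q: "Q (Q v) = Q v"
  by (simp_all add: Q_def linear_diff[OF lin] A_A)

lemma A_flip: "A (flip v) = A v" and Q_flip: "Q (flip v) = - Q v"
  by (simp_all add: flip_def linear_diff[OF lin] linear_diff[OF linear_Q] A_A A_Q Q_A Q_Q)

lemma linear_flip: "linear flip"
  unfolding flip_def[abs_def] by (intro linear_compose_sub lin linear_Q)

lemma norm_split: "(norm v)\<^sup>2 = (norm (A v))\<^sup>2 + (norm (Q v))\<^sup>2"
proof -
  have "(norm (A v + Q v))\<^sup>2 = (norm (A v))\<^sup>2 + (norm (Q v))\<^sup>2"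
    by (rule norm_add_Pythagorean) (simp add: orthogonal_def Q_def orth)
  then show ?thesis by (simp add: Q_def)
qed

lemma norm_A_le: "norm (A v) \<le> norm v" and norm_Q_le: "norm (Q v) \<le> norm v"
  using norm_split[of v]
    power2_le_imp_le[of "norm (A v)" "norm v"] power2_le_imp_le[of "norm (Q v)" "norm v"] by simp_all

lemma norm_le_split: "norm v \<le> norm (A v) + norm (Q v)"
  using norm_triangle_ineq[of "A v" "Q v"] by (simp add: Q_def)

lemma norm_flip: "norm (flip v) = norm v"
  using norm_split[of v] norm_split[of "flip v"]
  by (simp add: A_flip Q_flip) (metis norm_ge_zero power2_eq_imp_eq)

lemma flip_flip: "flip (flip v) = v"
  by (simp add: flip_def[of "flip v"] A_flip Q_flip) (simp add: Q_def)

lemma borel_A [measurable]: "A \<in> borel_measurable borel" and borel_Q [measurable]: "Q \<in> borel_measurable borel"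
  and borel_flip [measurable]: "flip \<in> borel_measurable borel"
  using lin linear_Q linear_flip
  by (auto intro!: borel_measurable_continuous_onI linear_continuous_on simp: linear_conv_bounded_linear)

lemma borel_box [measurable]: "box z r1 r2 \<in> sets borel"
  unfolding box_def by measurable

lemma box_subset: "box z r1 r2 \<subseteq> cball z (r1 + r2)"
proof
  fix w assume "w \<in> box z r1 r2"
  then have "norm (w - z) \<le> r1 + r2" using norm_le_split[of "w - z"] by (simp add: box_def)
  then show "w \<in> cball z (r1 + r2)" by (simp add: dist_norm norm_minus_commute)
qed

lemma ball_subset_box: "r1 \<le> r2 \<Longrightarrow> ball z r1 \<subseteq> box z r1 r2"
  using norm_A_le norm_Q_le by (force simp: box_def dist_norm norm_minus_commute intro: order_trans)

lemma emeasure_box_finite: "emeasure lborel (box z r1 r2) < \<infinity>"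
  by (rule emeasure_bounded_finite) (rule bounded_subset[OF bounded_cball box_subset])

lemma integrable_box:
  fixes f :: "'a \<Rightarrow> 'c::{banach, second_countable_topology}"
  assumes "f \<in> borel_measurable borel" "\<And>y. y \<in> box z r1 r2 \<Longrightarrow> norm (f y) \<le> B"
  shows "integrable lborel (\<lambda>y. indicator (box z r1 r2) y *\<^sub>R f y)"
  using assms emeasure_box_finite by (intro integrableI_bounded_set_indicator[where B=B]) auto

lemma integral_flip:
  fixes h :: "'a \<Rightarrow> 'c::{banach, second_countable_topology}"
  assumes [measurable]: "h \<in> borel_measurable borel"
  shows "(\<integral>y. h (x + flip (y - x)) \<partial>lborel) = (\<integral>y. h y \<partial>lborel)"
proof -
  have "(\<integral>y. h y \<partial>lborel) = (\<integral>y. h ((x - flip x) + y) \<partial>lborel)"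
    by (subst lborel_distr_plus[symmetric, of "x - flip x"]) (simp add: integral_distr)
  also have "\<dots> = (\<integral>y. h ((x - flip x) + flip y) \<partial>lborel)"
    by (subst lborel_distr_linear_isometry[OF linear_flip norm_flip, symmetric]) (simp add: integral_distr)
  finally show ?thesis by (simp add: linear_diff[OF linear_flip] algebra_simps)
qed

text \<open>On the part of the box that is symmetric under the reflection \<open>y \<mapsto> x + flip (y - x)\<close> the
  integrand \<open>gauss \<sigma> (y - x) *\<^sub>R Q (y - x)\<close> is odd; the rest of the box lies in the tail.\<close>

lemma norm_box_centred_moment_le:
  assumes B: "\<And>y. y \<in> box z r1 r2 \<Longrightarrow> r2 / 2 \<le> norm (y - x) \<Longrightarrow> norm (gauss \<sigma> (y - x) *\<^sub>R Q (y - x)) \<le> B"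
    and B0: "B \<ge> 0" and xz: "norm (Q (x - z)) \<le> r2 / 2"
  shows "norm (\<integral>y. indicator (box z r1 r2) y *\<^sub>R gauss \<sigma> (y - x) *\<^sub>R Q (y - x) \<partial>lborel)
    \<le> B * measure lborel (box z r1 r2)"
proof -
  let ?V = "box z r1 r2" and ?g = "\<lambda>y. gauss \<sigma> (y - x) *\<^sub>R Q (y - x)" and ?\<rho> = "\<lambda>y. x + flip (y - x)"
  define S where "S = {y \<in> ?V. ?\<rho> y \<in> ?V}"
  have [measurable]: "S \<in> sets borel" unfolding S_def by measurable
  have SV: "S \<subseteq> ?V" by (auto simp: S_def)
  define h1 where "h1 y = indicator S y *\<^sub>R ?g y" for y
  define h2 where "h2 y = indicator (?V - S) y *\<^sub>R ?g y" for y
  have [measurable]: "h1 \<in> borel_measurable borel" "h2 \<in> borel_measurable borel"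
    unfolding h1_def[abs_def] h2_def[abs_def] by measurable
  have "h1 (?\<rho> y) = - h1 y" for y
  proof -
    have "?\<rho> y \<in> S \<longleftrightarrow> y \<in> S" by (auto simp: S_def flip_flip)
    moreover have "gauss \<sigma> (flip (y - x)) = gauss \<sigma> (y - x)"
      by (rule gauss_norm_cong) (rule norm_flip)
    ultimately show ?thesis by (simp add: h1_def indicator_def Q_flip)
  qed
  then have "(\<integral>y. h1 y \<partial>lborel) = - (\<integral>y. h1 y \<partial>lborel)"
    using integral_flip[of h1 x] by simp
  then have h1: "(\<integral>y. h1 y \<partial>lborel) = 0"
    by (metis eq_neg_iff_add_eq_0 scaleR_2 scaleR_eq_0_iff zero_neq_numeral)
  have tail: "norm (h2 y) \<le> indicator ?V y * B" for y
  proof (cases "y \<in> ?V - S")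
    case True
    then have yV: "y \<in> ?V" and "?\<rho> y \<notin> ?V" by (auto simp: S_def)
    \<comment> \<open>The reflection leaves the tangential coordinate unchanged, so it can leave the
      box only in the normal direction; this forces \<open>y\<close> far from
      \<open>x\<close>.\<close>
    moreover have "A (?\<rho> y - z) = A (y - z)" "Q (?\<rho> y - z) = Q (x - z) - Q (y - x)"
    proof -
      have eq: "?\<rho> y - z = flip (y - x) + (x - z)" by simp
      have "A (y - z) = A (y - x) + A (x - z)" using linear_add[OF lin, of "y - x" "x - z"] by simp
      then show "A (?\<rho> y - z) = A (y - z)"
        unfolding eq by (simp only: linear_add[OF lin] A_flip)
      show "Q (?\<rho> y - z) = Q (x - z) - Q (y - x)"
        unfolding eq by (simp only: linear_add[OF linear_Q] Q_flip) simp
    qed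
    ultimately have "r2 < norm (Q (x - z) - Q (y - x))" by (auto simp: box_def)
    also have "\<dots> \<le> r2 / 2 + norm (y - x)"
      using norm_triangle_ineq4[of "Q (x - z)" "Q (y - x)"] norm_Q_le[of "y - x"] xz by linarith
    finally have "r2 / 2 \<le> norm (y - x)" by simp
    then show ?thesis using B[OF yV] True by (simp add: h2_def)
  qed (use B0 in \<open>simp add: h2_def\<close>)
  have iV: "integrable lborel (\<lambda>y. indicator ?V y * B)"
    using emeasure_box_finite by (intro integrable_mult_left integrable_real_indicator) auto
  have ih2: "integrable lborel h2"
    by (rule Bochner_Integration.integrable_bound[OF iV]) (use tail B0 in \<open>auto intro: order_trans\<close>)
  have "(\<integral>y. indicator ?V y *\<^sub>R ?g y \<partial>lborel) = (\<integral>y. h1 y + h2 y \<partial>lborel)"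
    using SV by (intro Bochner_Integration.integral_cong) (auto simp: h1_def h2_def indicator_def)
  also have "\<dots> = (\<integral>y. h2 y \<partial>lborel)"
  proof -
    have "norm (indicator S y *\<^sub>R ?g y) \<le> gauss \<sigma> (0::'a) * (norm (z - x) + \<bar>r1 + r2\<bar>)" if "y \<in> ?V" for y
    proof -
      have "norm (Q (y - x)) \<le> norm (z - x) + \<bar>r1 + r2\<bar>"
        using norm_Q_le[of "y - x"] box_subset[of z r1 r2] that norm_triangle_ineq[of "y - z" "z - x"]
        by (force simp: dist_norm norm_minus_commute)
      then have "norm (?g y) \<le> gauss \<sigma> (0::'a) * (norm (z - x) + \<bar>r1 + r2\<bar>)"
        by (intro norm_gauss_scaleR_le gauss_antimono) auto
      then show ?thesis using gauss_nonneg[of \<sigma> "0::'a"] by (auto simp: indicator_def intro: order_trans[OF norm_ge_zero])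
    qed
    then have "integrable lborel (\<lambda>y. indicator ?V y *\<^sub>R (indicator S y *\<^sub>R ?g y))"
      by (intro integrable_box) auto
    moreover have "h1 = (\<lambda>y. indicator ?V y *\<^sub>R (indicator S y *\<^sub>R ?g y))"
      using SV by (auto simp: h1_def indicator_def fun_eq_iff)
    ultimately show ?thesis using ih2 h1 by simp
  qed
  finally have "norm (\<integral>y. indicator ?V y *\<^sub>R ?g y \<partial>lborel) \<le> (\<integral>y. norm (h2 y) \<partial>lborel)"
    by simp
  also have "\<dots> \<le> (\<integral>y. indicator ?V y * B \<partial>lborel)"
    using ih2 iV tail by (intro integral_mono) auto
  also have "\<dots> = B * measure lborel ?V" by simp
  finally show ?thesis .
qed

text \<open>The box lies within \<open>5 / 4 * r2\<close> of \<open>z\<close>, hence within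
  \<open>2 * r2\<close> of \<open>p\<close>. Thus \<open>x\<close> at distance \<open>3 * r2\<close>
  from \<open>p\<close> puts the whole box in the tail, and for closer \<open>x\<close> the normal
  offset is at most \<open>5 * r2\<close>. The bound on \<open>L * r2\<close> keeps
  \<open>Q (x - z)\<close> below \<open>r2 / 2\<close>, as the reflection argument requires; the
  \<open>9\<close> is the square of \<open>3\<close>.\<close>

lemma norm_box_moment_le:
  assumes r: "0 \<le> r1" "r1 \<le> r2 / 4" and zp: "norm (z - p) \<le> r2 / 8"
    and L: "L \<ge> 0" "9 * L * r2 \<le> 1 / 8" and quad: "norm (Q (x - p)) \<le> L * (norm (x - p))\<^sup>2"
  shows "norm (\<integral>y. indicator (box z r1 r2) y *\<^sub>R gauss \<sigma> (y - x) *\<^sub>R Q (y - p) \<partial>lborel)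
    \<le> 9 * L * r2\<^sup>2 * (\<integral>y. indicator (box z r1 r2) y *\<^sub>R gauss \<sigma> (y - x) \<partial>lborel)
      + gauss \<sigma> (0::'a) * exp (- r2\<^sup>2 / (8 * \<sigma>\<^sup>2)) * (5 * r2) * measure lborel (box z r1 r2)"
    (is "_ \<le> _ * ?W + ?B * _")
proof -
  let ?V = "box z r1 r2"
  have r2: "0 \<le> r2" using r by simp
  have B: "?B \<ge> 0" using r2 gauss_nonneg[of \<sigma> "0::'a"] by simp
  have yz: "norm (y - z) \<le> 5 / 4 * r2" if "y \<in> ?V" for y
    using box_subset[of z r1 r2] that r by (force simp: dist_norm norm_minus_commute)
  have yp: "norm (y - p) \<le> 2 * r2" if "y \<in> ?V" for y
    using yz[OF that] zp r2 norm_triangle_ineq[of "y - z" "z - p"] by simp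
  have g0: "gauss \<sigma> (y - x) \<le> gauss \<sigma> (0::'a)" for y by (rule gauss_antimono) simp
  have W: "0 \<le> ?W" by (intro Bochner_Integration.integral_nonneg) (simp add: gauss_nonneg)
  show ?thesis
  proof (cases "3 * r2 \<le> norm (x - p)")
    case True
    have bnd: "norm (gauss \<sigma> (y - x) *\<^sub>R Q (y - p)) \<le> ?B" if y: "y \<in> ?V" for y
    proof -
      have "norm (x - p) \<le> norm (y - p) + norm (y - x)"
        using norm_triangle_ineq4[of "y - p" "y - x"] by simp
      then have "r2 / 2 \<le> norm (y - x)" using True yp[OF y] r2 by linarith
      then have "gauss \<sigma> (y - x) \<le> gauss \<sigma> (0::'a) * exp (- r2\<^sup>2 / (8 * \<sigma>\<^sup>2))"
        using r2 by (rule gauss_tail)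
      moreover have "norm (Q (y - p)) \<le> 5 * r2" using norm_Q_le[of "y - p"] yp[OF y] r2 by linarith
      ultimately show ?thesis by (rule norm_gauss_scaleR_le)
    qed
    have iV: "integrable lborel (\<lambda>y. indicator ?V y * ?B)"
      using emeasure_box_finite by (intro integrable_mult_left integrable_real_indicator) auto
    have "norm (\<integral>y. indicator ?V y *\<^sub>R gauss \<sigma> (y - x) *\<^sub>R Q (y - p) \<partial>lborel)
      \<le> (\<integral>y. norm (indicator ?V y *\<^sub>R gauss \<sigma> (y - x) *\<^sub>R Q (y - p)) \<partial>lborel)"
      by (rule integral_norm_bound)
    also have "\<dots> \<le> (\<integral>y. indicator ?V y * ?B \<partial>lborel)"
      using bnd B by (intro integral_mono iV integrable_norm integrable_box[where B="?B"])
        (auto simp: indicator_def)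
    also have "\<dots> = ?B * measure lborel ?V" by simp
    finally show ?thesis using W L by (smt (verit) mult_nonneg_nonneg zero_le_power2)
  next
    case False
    have "(norm (x - p))\<^sup>2 \<le> (3 * r2)\<^sup>2" using False by (intro power_mono) auto
    then have "L * (norm (x - p))\<^sup>2 \<le> L * (3 * r2)\<^sup>2" using L by (intro mult_left_mono)
    then have Qx: "norm (Q (x - p)) \<le> 9 * L * r2\<^sup>2" using quad by (simp add: power2_eq_square)
    have "9 * L * r2\<^sup>2 \<le> 1 / 8 * r2"
      using mult_right_mono[OF L(2) r2] by (simp add: power2_eq_square)
    moreover have "Q (x - z) = Q (x - p) - Q (z - p)" by (simp add: linear_diff[OF linear_Q, symmetric])
    ultimately have xz: "norm (Q (x - z)) \<le> r2 / 2"
      using Qx norm_triangle_ineq4[of "Q (x - p)" "Q (z - p)"] norm_Q_le[of "z - p"] zp r2 by simp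
    have yx: "norm (Q (y - x)) \<le> 5 * r2" if "y \<in> ?V" for y
      using norm_Q_le[of "y - x"] yp[OF that] False norm_triangle_ineq4[of "y - p" "x - p"] by simp
    have i1: "integrable lborel (\<lambda>y. indicator ?V y *\<^sub>R gauss \<sigma> (y - x) *\<^sub>R Q (y - x))"
      using yx g0 by (intro integrable_box[where B="gauss \<sigma> (0::'a) * (5 * r2)"] norm_gauss_scaleR_le) auto
    have i2: "integrable lborel (\<lambda>y. indicator ?V y *\<^sub>R gauss \<sigma> (y - x))"
      using g0 gauss_nonneg
      by (intro integrable_box[where B="gauss \<sigma> (0::'a)"]) (auto simp: abs_of_nonneg)
    have "(\<integral>y. indicator ?V y *\<^sub>R gauss \<sigma> (y - x) *\<^sub>R Q (y - p) \<partial>lborel)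
      = (\<integral>y. indicator ?V y *\<^sub>R gauss \<sigma> (y - x) *\<^sub>R Q (y - x) + (indicator ?V y *\<^sub>R gauss \<sigma> (y - x)) *\<^sub>R Q (x - p) \<partial>lborel)"
    proof (intro Bochner_Integration.integral_cong refl)
      fix y
      have "Q (y - p) = Q (y - x) + Q (x - p)" by (simp add: linear_add[OF linear_Q, symmetric])
      then show "indicator ?V y *\<^sub>R gauss \<sigma> (y - x) *\<^sub>R Q (y - p) = indicator ?V y *\<^sub>R gauss \<sigma> (y - x) *\<^sub>R Q (y - x) + (indicator ?V y *\<^sub>R gauss \<sigma> (y - x)) *\<^sub>R Q (x - p)"
        by (simp add: scaleR_add_right)
    qed
    also have "\<dots> = (\<integral>y. indicator ?V y *\<^sub>R gauss \<sigma> (y - x) *\<^sub>R Q (y - x) \<partial>lborel) + ?W *\<^sub>R Q (x - p)"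
      using i1 i2 by (subst Bochner_Integration.integral_add) auto
    finally have eq: "(\<integral>y. indicator ?V y *\<^sub>R gauss \<sigma> (y - x) *\<^sub>R Q (y - p) \<partial>lborel) = \<dots>" .
    have "norm (\<integral>y. indicator ?V y *\<^sub>R gauss \<sigma> (y - x) *\<^sub>R Q (y - x) \<partial>lborel) \<le> ?B * measure lborel ?V"
    proof (rule norm_box_centred_moment_le[OF _ B xz])
      fix y assume "y \<in> ?V" "r2 / 2 \<le> norm (y - x)"
      then show "norm (gauss \<sigma> (y - x) *\<^sub>R Q (y - x)) \<le> ?B"
        using r2 yx by (intro norm_gauss_scaleR_le gauss_tail) auto
    qed
    moreover have "norm (?W *\<^sub>R Q (x - p)) \<le> 9 * L * r2\<^sup>2 * ?W"
      using W mult_right_mono[OF Qx W] by (simp add: mult.commute)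
    ultimately show ?thesis unfolding eq by (intro order_trans[OF norm_triangle_ineq]) linarith
  qed
qed

end

subsection \<open>Mixtures of Gaussians\<close>

lemma gauss_mixture:
  fixes \<mu> :: "'a::euclidean_space measure"
  assumes fin: "finite_measure \<mu>" and sets [measurable_cong]: "sets \<mu> = sets borel"
  shows "integrable \<mu> (\<lambda>x. gauss \<sigma> (y - x))"
    and "(\<lambda>y. \<integral>x. gauss \<sigma> (y - x) \<partial>\<mu>) \<in> borel_measurable borel"
    and "norm (\<integral>x. gauss \<sigma> (y - x) \<partial>\<mu>) \<le> gauss \<sigma> (0::'a) * measure \<mu> UNIV"
proof -
  interpret finite_measure \<mu> by (rule fin)
  have sp: "space \<mu> = UNIV" using sets_eq_imp_space_eq[OF sets] by simp
  have g0: "gauss \<sigma> v \<le> gauss \<sigma> (0::'a)" for v :: 'a by (rule gauss_antimono) simp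
  show ig: "integrable \<mu> (\<lambda>x. gauss \<sigma> (y - x))" for y
    using g0 by (intro integrable_const_bound[where B="gauss \<sigma> (0::'a)"]) auto
  show "(\<lambda>y. \<integral>x. gauss \<sigma> (y - x) \<partial>\<mu>) \<in> borel_measurable borel" by measurable
  have "(\<integral>x. gauss \<sigma> (y - x) \<partial>\<mu>) \<le> (\<integral>x. gauss \<sigma> (0::'a) \<partial>\<mu>)"
    using ig g0 by (intro integral_mono) auto
  moreover have "0 \<le> (\<integral>x. gauss \<sigma> (y - x) \<partial>\<mu>)"
    by (intro Bochner_Integration.integral_nonneg) (rule gauss_nonneg)
  ultimately show "norm (\<integral>x. gauss \<sigma> (y - x) \<partial>\<mu>) \<le> gauss \<sigma> (0::'a) * measure \<mu> UNIV"
    by (simp add: sp mult.commute)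
qed

context orthogonal_splitting
begin

text \<open>Integrates the bound for fixed \<open>x\<close> over \<open>\<mu>\<close>. Fubini
  applies because the integrands are bounded and supported on a product of finite measure; the
  quadratic bound is only required almost everywhere since it holds for points of
  \<open>M\<close>.\<close>

lemma norm_box_mixture_moment_le:
  fixes \<mu> :: "'a measure"
  assumes fin: "finite_measure \<mu>" and sets [measurable_cong]: "sets \<mu> = sets borel"
    and r: "0 \<le> r1" "r1 \<le> r2 / 4" and zp: "norm (z - p) \<le> r2 / 8"
    and L: "L \<ge> 0" "9 * L * r2 \<le> 1 / 8" and quad: "AE x in \<mu>. norm (Q (x - p)) \<le> L * (norm (x - p))\<^sup>2"
  shows "norm (\<integral>y. indicator (box z r1 r2) y *\<^sub>R (\<integral>x. gauss \<sigma> (y - x) \<partial>\<mu>) *\<^sub>R Q (y - p) \<partial>lborel)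
    \<le> 9 * L * r2\<^sup>2 * (\<integral>y. indicator (box z r1 r2) y *\<^sub>R (\<integral>x. gauss \<sigma> (y - x) \<partial>\<mu>) \<partial>lborel)
      + gauss \<sigma> (0::'a) * exp (- r2\<^sup>2 / (8 * \<sigma>\<^sup>2)) * (5 * r2) * measure lborel (box z r1 r2) * measure \<mu> UNIV"
    (is "_ \<le> _ * _ + ?B * _ * _")
proof -
  let ?V = "box z r1 r2"
  interpret finite_measure \<mu> by (rule fin)
  interpret P: pair_sigma_finite \<mu> lborel ..
  have sp: "space \<mu> = UNIV" using sets_eq_imp_space_eq[OF sets] by simp
  define F1 where "F1 x y = indicator ?V y *\<^sub>R gauss \<sigma> (y - x) *\<^sub>R Q (y - p)" for x y
  define F2 where "F2 x y = indicator ?V y *\<^sub>R gauss \<sigma> (y - x)" for x y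
  have g0: "gauss \<sigma> v \<le> gauss \<sigma> (0::'a)" for v :: 'a by (rule gauss_antimono) simp
  have finV: "emeasure (\<mu> \<Otimes>\<^sub>M lborel) (UNIV \<times> ?V) < \<infinity>"
  proof -
    have "UNIV \<in> sets \<mu>" using sp by (metis sets.top)
    then show ?thesis
      using emeasure_box_finite[of z r1 r2] emeasure_finite[of UNIV]
      by (subst lborel.emeasure_pair_measure_Times) (auto simp: ennreal_mult_less_top less_top[symmetric] ennreal_mult_eq_top_iff)
  qed
  have UV: "UNIV \<times> ?V \<in> sets (\<mu> \<Otimes>\<^sub>M lborel)"
    using sp by (intro pair_measureI) (auto intro: sets.top[of \<mu>, unfolded sp])
  have yp: "norm (Q (y - p)) \<le> r1 + r2 + norm (z - p)" if "y \<in> ?V" for y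
  proof -
    have "norm (y - z) \<le> r1 + r2"
      using box_subset[of z r1 r2] that by (force simp: dist_norm norm_minus_commute)
    then show ?thesis using norm_Q_le[of "y - p"] norm_triangle_ineq[of "y - z" "z - p"] by simp
  qed
  have i1: "integrable (\<mu> \<Otimes>\<^sub>M lborel) (case_prod F1)"
  proof (rule integrableI_bounded_set[OF UV _ finV])
    show "case_prod F1 \<in> borel_measurable (\<mu> \<Otimes>\<^sub>M lborel)"
      unfolding F1_def[abs_def] by measurable
    show "AE q in \<mu> \<Otimes>\<^sub>M lborel. q \<in> UNIV \<times> ?V \<longrightarrow> norm (case_prod F1 q) \<le> gauss \<sigma> (0::'a) * (r1 + r2 + norm (z - p))"
      using yp g0 by (intro AE_I2) (auto simp: F1_def simp del: norm_scaleR intro!: norm_gauss_scaleR_le)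
    show "AE q in \<mu> \<Otimes>\<^sub>M lborel. q \<notin> UNIV \<times> ?V \<longrightarrow> case_prod F1 q = 0"
      by (intro AE_I2) (auto simp: F1_def indicator_def)
  qed
  have i2: "integrable (\<mu> \<Otimes>\<^sub>M lborel) (case_prod F2)"
  proof (rule integrableI_bounded_set[OF UV _ finV])
    show "case_prod F2 \<in> borel_measurable (\<mu> \<Otimes>\<^sub>M lborel)"
      unfolding F2_def[abs_def] by measurable
    show "AE q in \<mu> \<Otimes>\<^sub>M lborel. q \<in> UNIV \<times> ?V \<longrightarrow> norm (case_prod F2 q) \<le> gauss \<sigma> (0::'a)"
      using g0 by (intro AE_I2) (auto simp: F2_def)
    show "AE q in \<mu> \<Otimes>\<^sub>M lborel. q \<notin> UNIV \<times> ?V \<longrightarrow> case_prod F2 q = 0"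
      by (intro AE_I2) (auto simp: F2_def indicator_def)
  qed
  note ig = gauss_mixture(1)[OF fin sets]
  have e1: "(\<integral>y. indicator ?V y *\<^sub>R (\<integral>x. gauss \<sigma> (y - x) \<partial>\<mu>) *\<^sub>R Q (y - p) \<partial>lborel) = (\<integral>x. (\<integral>y. F1 x y \<partial>lborel) \<partial>\<mu>)"
    unfolding P.Fubini_integral[OF i1, symmetric] using ig by (simp add: F1_def)
  have e2: "(\<integral>y. indicator ?V y *\<^sub>R (\<integral>x. gauss \<sigma> (y - x) \<partial>\<mu>) \<partial>lborel) = (\<integral>x. (\<integral>y. F2 x y \<partial>lborel) \<partial>\<mu>)"
    unfolding P.Fubini_integral[OF i2, symmetric] using ig by (simp add: F2_def)
  have j1: "integrable \<mu> (\<lambda>x. \<integral>y. F1 x y \<partial>lborel)" using P.integrable_fst[OF i1] by simp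
  have j2: "integrable \<mu> (\<lambda>x. \<integral>y. F2 x y \<partial>lborel)" using P.integrable_fst[OF i2] by simp
  have "norm (\<integral>x. (\<integral>y. F1 x y \<partial>lborel) \<partial>\<mu>) \<le> (\<integral>x. norm (\<integral>y. F1 x y \<partial>lborel) \<partial>\<mu>)" by simp
  also have "\<dots> \<le> (\<integral>x. 9 * L * r2\<^sup>2 * (\<integral>y. F2 x y \<partial>lborel) + ?B * measure lborel ?V \<partial>\<mu>)"
  proof (rule integral_mono_AE)
    show "AE x in \<mu>. norm (\<integral>y. F1 x y \<partial>lborel) \<le> 9 * L * r2\<^sup>2 * (\<integral>y. F2 x y \<partial>lborel) + ?B * measure lborel ?V"
      using quad
    proof eventually_elim
      fix x assume "norm (Q (x - p)) \<le> L * (norm (x - p))\<^sup>2"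
      from norm_box_moment_le[OF r zp L this]
      show "norm (\<integral>y. F1 x y \<partial>lborel) \<le> 9 * L * r2\<^sup>2 * (\<integral>y. F2 x y \<partial>lborel) + ?B * measure lborel ?V"
        unfolding F1_def F2_def .
    qed
  qed (use j1 j2 in auto)
  also have "\<dots> = 9 * L * r2\<^sup>2 * (\<integral>x. (\<integral>y. F2 x y \<partial>lborel) \<partial>\<mu>) + ?B * measure lborel ?V * measure \<mu> UNIV"
    using j2 by (simp add: sp)
  finally show ?thesis unfolding e1 e2 .
qed

text \<open>Only \<open>x\<close> in \<open>ball p s\<close> and \<open>y\<close> in
  \<open>ball z r1\<close> are kept, where the kernel is bounded below. For radii of order
  \<open>\<sigma>\<close> these balls supply the powers \<open>\<sigma> ^ d\<close> and
  \<open>\<sigma> ^ D\<close>.\<close>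

lemma box_mixture_mass_ge:
  fixes \<mu> :: "'a measure"
  assumes fin: "finite_measure \<mu>" and sets [measurable_cong]: "sets \<mu> = sets borel"
    and r: "r1 \<le> r2" and near: "\<And>x y. x \<in> ball p s \<Longrightarrow> y \<in> ball z r1 \<Longrightarrow> norm (y - x) \<le> \<rho>" and \<rho>: "0 \<le> \<rho>"
  shows "gauss \<sigma> (0::'a) * exp (- \<rho>\<^sup>2 / (2 * \<sigma>\<^sup>2)) * measure \<mu> (ball p s) * measure lborel (ball z r1)
    \<le> (\<integral>y. indicator (box z r1 r2) y *\<^sub>R (\<integral>x. gauss \<sigma> (y - x) \<partial>\<mu>) \<partial>lborel)"
proof -
  let ?V = "box z r1 r2"
  interpret finite_measure \<mu> by (rule fin)
  have sp: "space \<mu> = UNIV" using sets_eq_imp_space_eq[OF sets] by simp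
  note ig = gauss_mixture(1)[OF fin sets]
  let ?k = "gauss \<sigma> (0::'a) * exp (- \<rho>\<^sup>2 / (2 * \<sigma>\<^sup>2))"
  have pos: "0 \<le> (\<integral>x. gauss \<sigma> (y - x) \<partial>\<mu>)" for y
    by (intro Bochner_Integration.integral_nonneg) (rule gauss_nonneg)
  have b: "ball p s \<in> sets \<mu>" by (simp add: sets)
  have inner: "?k * measure \<mu> (ball p s) \<le> (\<integral>x. gauss \<sigma> (y - x) \<partial>\<mu>)" if y: "y \<in> ball z r1" for y
  proof -
    have "?k * measure \<mu> (ball p s) = (\<integral>x. indicator (ball p s) x * ?k \<partial>\<mu>)" using b by simp
    also have "\<dots> \<le> (\<integral>x. gauss \<sigma> (y - x) \<partial>\<mu>)"
    proof (intro integral_mono ig integrable_mult_left integrable_real_indicator b)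
      fix x
      show "indicator (ball p s) x * ?k \<le> gauss \<sigma> (y - x)"
      proof (cases "x \<in> ball p s")
        case True
        then have "(norm (y - x))\<^sup>2 \<le> \<rho>\<^sup>2" using near y by (intro power_mono) auto
        then have "- \<rho>\<^sup>2 / (2 * \<sigma>\<^sup>2) \<le> - (norm (y - x))\<^sup>2 / (2 * \<sigma>\<^sup>2)" by (intro divide_right_mono) auto
        then show ?thesis unfolding gauss_eq[of \<sigma> "y - x"] using True
          by (simp add: mult_left_mono gauss_nonneg)
      qed (simp add: gauss_nonneg)
    qed (simp add: less_top[symmetric] emeasure_finite)
    finally show ?thesis .
  qed
  have iG: "integrable lborel (\<lambda>y. indicator ?V y *\<^sub>R (\<integral>x. gauss \<sigma> (y - x) \<partial>\<mu>))"
    using gauss_mixture[OF fin sets, of \<sigma>]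
    by (intro integrable_box[where B="gauss \<sigma> (0::'a) * measure \<mu> UNIV"]) auto
  have "?k * measure \<mu> (ball p s) * measure lborel (ball z r1)
    = (\<integral>y. indicator (ball z r1) y * (?k * measure \<mu> (ball p s)) \<partial>lborel)" by simp
  also have "\<dots> \<le> (\<integral>y. indicator ?V y *\<^sub>R (\<integral>x. gauss \<sigma> (y - x) \<partial>\<mu>) \<partial>lborel)"
  proof (intro integral_mono iG integrable_mult_left integrable_real_indicator)
    fix y
    show "indicator (ball z r1) y * (?k * measure \<mu> (ball p s)) \<le> indicator ?V y *\<^sub>R (\<integral>x. gauss \<sigma> (y - x) \<partial>\<mu>)"
      using inner[of y] ball_subset_box[OF r, of z] pos[of y] by (auto simp: indicator_def)
  qed (use emeasure_bounded_finite[OF bounded_ball, of z r1] in auto)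
  finally show ?thesis .
qed

text \<open>Division by the mass \<open>P\<close> turns the curvature term into
  \<open>9 * L * r2 ^ 2\<close>. In the tail term the normalising factor of the Gaussian and the
  unit ball volume cancel, and the surplus power \<open>\<sigma> ^ 2\<close> remains.\<close>

lemma norm_conditional_mean_le:
  fixes \<mu> :: "'a measure"
  assumes fin: "finite_measure \<mu>" and sets: "sets \<mu> = sets borel"
    and \<sigma>: "0 < \<sigma>" "\<sigma> < 1" and c: "0 < c" "c < 1" and C0: "C0 > 0"
    and r2: "r2 = C1 * \<sigma> * sqrt (ln (1 / \<sigma>))" "r2 \<le> 1 / 5"
    and large: "4 * c * \<sigma> \<le> r2" "8 * C0 * \<sigma> \<le> r2" and C1: "C1\<^sup>2 / 8 \<ge> real (DIM('a) + d + 2)"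
    and zp: "norm (z - p) \<le> C0 * \<sigma>"
    and L: "L \<ge> 0" "9 * L * r2 \<le> 1 / 8" and quad: "AE x in \<mu>. norm (Q (x - p)) \<le> L * (norm (x - p))\<^sup>2"
    and m: "m > 0" "m * \<sigma> ^ d \<le> measure \<mu> (ball p \<sigma>)"
  defines "P \<equiv> (\<integral>y. indicator (box z (c * \<sigma>) r2) y *\<^sub>R (\<integral>x. gauss \<sigma> (y - x) \<partial>\<mu>) \<partial>lborel)"
  shows "P > 0" and
    "norm ((1 / P) *\<^sub>R (\<integral>y. indicator (box z (c * \<sigma>) r2) y *\<^sub>R (\<integral>x. gauss \<sigma> (y - x) \<partial>\<mu>) *\<^sub>R Q (y - p) \<partial>lborel))
    \<le> 9 * L * C1\<^sup>2 * (\<sigma>\<^sup>2 * ln (1 / \<sigma>)) + measure \<mu> UNIV / (exp (- (C0 + 2)\<^sup>2 / 2) * m * c ^ DIM('a)) * \<sigma>\<^sup>2"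
proof -
  let ?V = "box z (c * \<sigma>) r2" and ?D = "DIM('a)"
  interpret finite_measure \<mu> by (rule fin)
  have c\<sigma>: "0 < c * \<sigma>" using c \<sigma> by simp
  with large(1) have r2pos: "0 < r2" by linarith
  have ln0: "0 \<le> ln (1 / \<sigma>)" using \<sigma> by (simp add: ln_div)
  define u where "u = unit_ball_vol (real ?D)"
  have u: "u > 0" by (simp add: u_def)
  define k where "k = exp (- (C0 + 2)\<^sup>2 / 2)"
  have k: "k > 0" by (simp add: k_def)
  define g where "g = gauss \<sigma> (0::'a)"
  have g: "g > 0" using gauss_zero_pos \<sigma> by (simp add: g_def)
  \<comment> \<open>The factor \<open>C0 + 2\<close> collects the distances from \<open>y\<close> to
    \<open>z\<close>, \<open>z\<close> to \<open>p\<close> and \<open>p\<close> to \<open>x\<close>,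
    at most \<open>c * \<sigma>\<close>, \<open>C0 * \<sigma>\<close> and
    \<open>\<sigma>\<close>.\<close>
  have low: "g * (k * m * c ^ ?D * u) * \<sigma> ^ (d + ?D) \<le> P"
  proof -
    have "g * (k * m * c ^ ?D * u) * \<sigma> ^ (d + ?D) = g * k * (m * \<sigma> ^ d) * (u * (c * \<sigma>) ^ ?D)"
      by (simp add: power_add power_mult_distrib mult_ac)
    also have "\<dots> \<le> g * k * measure \<mu> (ball p \<sigma>) * (u * (c * \<sigma>) ^ ?D)"
      using g k m u c \<sigma> by (intro mult_right_mono mult_left_mono) auto
    also have "\<dots> = gauss \<sigma> (0::'a) * exp (- ((C0 + 2) * \<sigma>)\<^sup>2 / (2 * \<sigma>\<^sup>2)) * measure \<mu> (ball p \<sigma>) * measure lborel (ball z (c * \<sigma>))"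
      using \<sigma> c by (simp add: g_def k_def u_def content_ball power_mult_distrib)
    also have "\<dots> \<le> P"
      unfolding P_def
    proof (rule box_mixture_mass_ge[OF fin sets])
      show "c * \<sigma> \<le> r2" using large(1) c\<sigma> by linarith
      fix x y assume "x \<in> ball p \<sigma>" "y \<in> ball z (c * \<sigma>)"
      then have xy: "norm (p - x) \<le> \<sigma>" "norm (y - z) \<le> c * \<sigma>"
        by (auto simp: dist_norm norm_minus_commute)
      have "c * \<sigma> \<le> 1 * \<sigma>" using c \<sigma> by (intro mult_right_mono) auto
      moreover have "norm (y - x) \<le> norm (y - z) + norm (z - p) + norm (p - x)"
        using norm_triangle_ineq[of "y - z" "z - p"] norm_triangle_ineq[of "y - p" "p - x"] by simp
      ultimately show "norm (y - x) \<le> (C0 + 2) * \<sigma>" using xy zp by (simp add: algebra_simps)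
    qed (use C0 \<sigma> in auto)
    finally show ?thesis .
  qed
  have lowpos: "0 < g * (k * m * c ^ ?D * u) * \<sigma> ^ (d + ?D)"
    using g k m c u \<sigma> by simp
  with low show P: "P > 0" by linarith
  let ?N = "\<integral>y. indicator ?V y *\<^sub>R (\<integral>x. gauss \<sigma> (y - x) \<partial>\<mu>) *\<^sub>R Q (y - p) \<partial>lborel"
  \<comment> \<open>\<open>r2 \<le> 1 / 5\<close> puts the box inside the unit ball about
    \<open>z\<close>; it also absorbs the factor \<open>5 * r2\<close> below.\<close>
  have vol: "measure lborel ?V \<le> u"
  proof -
    have "?V \<subseteq> cball z 1" using box_subset[of z "c * \<sigma>" r2] large r2 r2pos by (force simp: subset_iff)
    then have "measure lborel ?V \<le> measure lborel (cball z 1)"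
      using emeasure_bounded_finite[OF bounded_cball, of z 1]
      by (intro measure_mono_fmeasurable) (auto simp: fmeasurable_def)
    then show ?thesis by (simp add: content_cball u_def)
  qed
  have tail: "exp (- r2\<^sup>2 / (8 * \<sigma>\<^sup>2)) \<le> \<sigma> ^ (?D + d + 2)"
  proof -
    have "- r2\<^sup>2 / (8 * \<sigma>\<^sup>2) = (C1\<^sup>2 / 8) * ln \<sigma>"
      using \<sigma> ln0 by (simp add: r2 power_mult_distrib ln_div)
    then have "exp (- r2\<^sup>2 / (8 * \<sigma>\<^sup>2)) = \<sigma> powr (C1\<^sup>2 / 8)" using \<sigma> by (simp add: powr_def)
    also have "\<dots> \<le> \<sigma> powr real (?D + d + 2)" using C1 \<sigma> by (intro powr_mono') auto
    also have "\<dots> = \<sigma> ^ (?D + d + 2)" using \<sigma>(1) by (rule powr_realpow)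
    finally show ?thesis .
  qed
  have "norm ?N \<le> 9 * L * r2\<^sup>2 * P
      + g * exp (- r2\<^sup>2 / (8 * \<sigma>\<^sup>2)) * (5 * r2) * measure lborel ?V * measure \<mu> UNIV"
    unfolding P_def g_def
    by (rule norm_box_mixture_moment_le[OF fin sets _ _ _ L quad]) (use large c \<sigma> zp in auto)
  also have "\<dots> \<le> 9 * L * r2\<^sup>2 * P + g * \<sigma> ^ (?D + d + 2) * 1 * u * measure \<mu> UNIV"
  proof (rule add_left_mono)
    have "g * exp (- r2\<^sup>2 / (8 * \<sigma>\<^sup>2)) * (5 * r2) \<le> g * \<sigma> ^ (?D + d + 2) * 1"
      using tail r2(2) r2pos g \<sigma> by (intro mult_mono) auto
    then show "g * exp (- r2\<^sup>2 / (8 * \<sigma>\<^sup>2)) * (5 * r2) * measure lborel ?V * measure \<mu> UNIV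
        \<le> g * \<sigma> ^ (?D + d + 2) * 1 * u * measure \<mu> UNIV"
      using g \<sigma> by (intro mult_right_mono[OF mult_mono[OF _ vol]]) auto
  qed
  \<comment> \<open>The tail is rewritten so that the lower bound \<open>low\<close> for
    \<open>P\<close> appears as a factor.\<close>
  also have "\<dots> = 9 * L * r2\<^sup>2 * P + measure \<mu> UNIV / (k * m * c ^ ?D) * \<sigma>\<^sup>2 * (g * (k * m * c ^ ?D * u) * \<sigma> ^ (d + ?D))"
    using k m c by (simp add: power_add power2_eq_square mult_ac)
  also have "\<dots> \<le> 9 * L * r2\<^sup>2 * P + measure \<mu> UNIV / (k * m * c ^ ?D) * \<sigma>\<^sup>2 * P"
    using low k m c by (intro add_left_mono mult_left_mono) auto
  also have "\<dots> = P * (9 * L * C1\<^sup>2 * (\<sigma>\<^sup>2 * ln (1 / \<sigma>)) + measure \<mu> UNIV / (k * m * c ^ ?D) * \<sigma>\<^sup>2)"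
    using ln0 by (simp add: r2 power_mult_distrib algebra_simps)
  finally show "norm ((1 / P) *\<^sub>R ?N) \<le> 9 * L * C1\<^sup>2 * (\<sigma>\<^sup>2 * ln (1 / \<sigma>))
      + measure \<mu> UNIV / (exp (- (C0 + 2)\<^sup>2 / 2) * m * c ^ ?D) * \<sigma>\<^sup>2"
    using P by (simp add: divide_le_eq mult.commute k_def)
qed

text \<open>Since \<open>z - p\<close> is normal, recentring from \<open>z\<close> to
  \<open>p\<close> adds the constant \<open>z - p\<close> under the average, and the bounded linear
  \<open>Q\<close> commutes with the integral.\<close>

lemma normal_conditional_mean_eq:
  fixes \<mu> :: "'a measure" and \<sigma> r1 r2 :: real and z p :: 'a
  assumes fin: "finite_measure \<mu>" and sets: "sets \<mu> = sets borel" and zp: "A (z - p) = 0"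
  defines "P \<equiv> (\<integral>y. indicator (box z r1 r2) y *\<^sub>R (\<integral>x. gauss \<sigma> (y - x) \<partial>\<mu>) \<partial>lborel)"
  assumes P: "P \<noteq> 0"
  shows "z + Q ((1 / P) *\<^sub>R (\<integral>y. indicator (box z r1 r2) y *\<^sub>R (\<integral>x. gauss \<sigma> (y - x) \<partial>\<mu>) *\<^sub>R (y - z) \<partial>lborel))
    = p + (1 / P) *\<^sub>R (\<integral>y. indicator (box z r1 r2) y *\<^sub>R (\<integral>x. gauss \<sigma> (y - x) \<partial>\<mu>) *\<^sub>R Q (y - p) \<partial>lborel)"
proof -
  let ?V = "box z r1 r2"
  define G where "G y = (\<integral>x. gauss \<sigma> (y - x) \<partial>\<mu>)" for y
  define B where "B = gauss \<sigma> (0::'a) * measure \<mu> UNIV"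
  have [measurable]: "G \<in> borel_measurable borel" and GB: "\<And>y. norm (G y) \<le> B"
    using gauss_mixture[OF fin sets, of \<sigma>] by (auto simp: G_def[abs_def] B_def)
  have yz: "norm (y - z) \<le> r1 + r2" if "y \<in> ?V" for y
    using box_subset[of z r1 r2] that by (force simp: dist_norm norm_minus_commute)
  have i1: "integrable lborel (\<lambda>y. indicator ?V y *\<^sub>R G y *\<^sub>R (y - z))"
    using GB yz by (intro integrable_box[where B="B * (r1 + r2)"])
      (auto intro!: mult_mono intro: order_trans[OF norm_ge_zero] order_trans[OF abs_ge_zero])
  have i2: "integrable lborel (\<lambda>y. indicator ?V y *\<^sub>R G y)"
    using GB by (intro integrable_box[where B=B]) auto
  have i3: "integrable lborel (\<lambda>y. indicator ?V y *\<^sub>R G y *\<^sub>R Q (y - z))"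
    using GB yz norm_Q_le by (intro integrable_box[where B="B * (r1 + r2)"])
      (auto intro!: mult_mono intro: order_trans[OF norm_ge_zero] order_trans[OF abs_ge_zero] order_trans)
  have Qz: "Q (z - p) = z - p" using zp by (simp add: Q_def)
  have "(\<integral>y. indicator ?V y *\<^sub>R G y *\<^sub>R Q (y - p) \<partial>lborel)
    = (\<integral>y. indicator ?V y *\<^sub>R G y *\<^sub>R Q (y - z) + (indicator ?V y *\<^sub>R G y) *\<^sub>R (z - p) \<partial>lborel)"
  proof (intro Bochner_Integration.integral_cong refl)
    fix y
    have "Q (y - p) = Q (y - z) + (z - p)" using Qz linear_add[OF linear_Q, of "y - z" "z - p"] by simp
    then show "indicator ?V y *\<^sub>R G y *\<^sub>R Q (y - p) = indicator ?V y *\<^sub>R G y *\<^sub>R Q (y - z) + (indicator ?V y *\<^sub>R G y) *\<^sub>R (z - p)"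
      by (simp add: scaleR_add_right)
  qed
  also have "\<dots> = (\<integral>y. indicator ?V y *\<^sub>R G y *\<^sub>R Q (y - z) \<partial>lborel) + P *\<^sub>R (z - p)"
    using i2 i3 by (subst Bochner_Integration.integral_add) (auto simp: P_def G_def)
  also have "(\<integral>y. indicator ?V y *\<^sub>R G y *\<^sub>R Q (y - z) \<partial>lborel) = (\<integral>y. Q (indicator ?V y *\<^sub>R G y *\<^sub>R (y - z)) \<partial>lborel)"
    by (simp add: linear_scale[OF linear_Q])
  also have "\<dots> = Q (\<integral>y. indicator ?V y *\<^sub>R G y *\<^sub>R (y - z) \<partial>lborel)"
    using linear_Q i1 by (intro integral_bounded_linear) (simp_all add: linear_conv_bounded_linear)
  finally show ?thesis
    using P by (simp add: G_def linear_scale[OF linear_Q] scaleR_add_right)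
qed

end

subsection \<open>Distance of the conditional mean to the manifold\<close>

text \<open>\<open>r2\<close> tends to zero but dominates every multiple of \<open>\<sigma>\<close>;
  \<open>1 \<le> ln (1 / \<sigma>)\<close> later absorbs the plain \<open>\<sigma> ^ 2\<close>
  term.\<close>

lemma box_scale_eventually:
  fixes \<epsilon> \<delta> C1 a :: real
  assumes "0 < \<epsilon>" "0 < C1" "0 < \<delta>"
  obtains \<sigma>0 where "0 < \<sigma>0"
    "\<And>\<sigma>. 0 < \<sigma> \<Longrightarrow> \<sigma> < \<sigma>0 \<Longrightarrow> \<sigma> < \<epsilon> \<and> 1 \<le> ln (1 / \<sigma>) \<and> C1 * \<sigma> * sqrt (ln (1 / \<sigma>)) \<le> \<delta> \<and> a * \<sigma> \<le> C1 * \<sigma> * sqrt (ln (1 / \<sigma>))"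
proof -
  have "((\<lambda>\<sigma>. \<sigma> * sqrt (ln (1 / \<sigma>))) \<longlongrightarrow> 0) (at_right (0::real))" by real_asymp
  then have "\<forall>\<^sub>F \<sigma> in at_right 0. \<sigma> * sqrt (ln (1 / \<sigma>)) < \<delta> / C1"
    using assms by (intro order_tendstoD) auto
  moreover have "filterlim (\<lambda>\<sigma>. sqrt (ln (1 / \<sigma>))) at_top (at_right (0::real))" by real_asymp
  then have "\<forall>\<^sub>F \<sigma> in at_right 0. max 1 (a / C1) \<le> sqrt (ln (1 / \<sigma>))"
    by (simp only: filterlim_at_top)
  moreover have "\<forall>\<^sub>F \<sigma> in at_right (0::real). \<sigma> < \<epsilon>" using assms by (simp add: eventually_at_right_less eventually_at_right_field) metis
  ultimately have "\<forall>\<^sub>F \<sigma> in at_right 0. 0 < \<sigma> \<longrightarrow> \<sigma> < \<epsilon> \<and> 1 \<le> ln (1 / \<sigma>) \<and> C1 * \<sigma> * sqrt (ln (1 / \<sigma>)) \<le> \<delta> \<and> a * \<sigma> \<le> C1 * \<sigma> * sqrt (ln (1 / \<sigma>))"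
  proof eventually_elim
    fix \<sigma> :: real
    assume *: "\<sigma> * sqrt (ln (1 / \<sigma>)) < \<delta> / C1" "max 1 (a / C1) \<le> sqrt (ln (1 / \<sigma>))" "\<sigma> < \<epsilon>"
    then have "a \<le> C1 * sqrt (ln (1 / \<sigma>))" using assms by (simp add: field_simps)
    then have "0 < \<sigma> \<longrightarrow> a * \<sigma> \<le> C1 * sqrt (ln (1 / \<sigma>)) * \<sigma>" by (simp add: mult_right_mono)
    then show "0 < \<sigma> \<longrightarrow> \<sigma> < \<epsilon> \<and> 1 \<le> ln (1 / \<sigma>) \<and> C1 * \<sigma> * sqrt (ln (1 / \<sigma>)) \<le> \<delta> \<and> a * \<sigma> \<le> C1 * \<sigma> * sqrt (ln (1 / \<sigma>))"
      using * assms by (simp add: field_simps)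
  qed
  then show ?thesis using that unfolding eventually_at_right_field by metis
qed

theorem theorem4p1:
  fixes M :: "'a::euclidean_space set" and V \<tau> :: real
  assumes "twice_diff_submanifold M TYPE('b::euclidean_space)"
    and "compact M" and "M \<noteq> {}"
    and "hausdorff DIM('b) M \<le> ennreal V"
    and "\<tau> > 0" and "reach M \<ge> ereal \<tau>"
  shows "\<forall>c C0. 0 < c \<and> c < 1 \<and> C0 > 1 \<longrightarrow>
           (\<exists>K > 1. \<forall>C1 \<ge> K. \<exists>C > 0. \<exists>\<sigma>0 > 0. \<forall>\<sigma>. 0 < \<sigma> \<and> \<sigma> < \<sigma>0 \<longrightarrow>
              (\<forall>z. infdist z M < C0 * \<sigma> \<longrightarrow>
                 infdist (mu_V DIM('b) M \<sigma> z (c * \<sigma>) (C1 * \<sigma> * sqrt (ln (1 / \<sigma>)))) M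
                   \<le> C * \<sigma>\<^sup>2 * ln (1 / \<sigma>)))"
proof (intro allI impI)
  fix c C0 :: real
  assume c: "0 < c \<and> c < 1 \<and> C0 > 1"
  let ?d = "DIM('b)" and ?D = "DIM('a)"
  define \<mu> where "\<mu> = hausdorff_on ?d M"
  have em: "emeasure \<mu> A = hausdorff ?d (A \<inter> M)" if "A \<in> sets borel" for A
    using that assms(2) by (simp add: \<mu>_def emeasure_hausdorff_on borel_compact)
  have sets: "sets \<mu> = sets borel" and sp: "space \<mu> = UNIV" by (simp_all add: \<mu>_def)
  have "emeasure \<mu> UNIV < \<infinity>" using em[of UNIV] assms(4) by (auto intro: le_less_trans)
  then have fin: "finite_measure \<mu>" by (intro finite_measureI) (simp add: sp)
  then interpret \<mu>: finite_measure \<mu> .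
  have Mc: "- M \<in> sets borel" using assms(2) by (intro borel_comp borel_compact)
  then have "emeasure \<mu> (- M) = 0"
    using em[of "- M"] by (simp add: hausdorff_empty)
  then have AEM: "AE x in \<mu>. x \<in> M"
    using Mc by (intro AE_I'[of "- M"]) (auto simp: null_sets_def sets)
  have uniq: "\<exists>!p. p \<in> M \<and> dist z p = infdist z M" if "infdist z M < \<tau> / 2" for z
    using reach_unique_nearest[OF assms(5,6) _ that] assms(5) by simp
  \<comment> \<open>Federer's bound with radius \<open>\<tau> / 4\<close>, strictly below the
    uniqueness radius \<open>\<tau> / 2\<close>, which is itself strictly below
    \<open>\<tau>\<close>: \<open>1 / (2 * (\<tau> / 4)) = 2 / \<tau>\<close>.\<close>
  define L where "L = 2 / \<tau>"
  have L: "L \<ge> 0" using assms(5) by (simp add: L_def)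
  have quad: "norm (nor_proj M p (x - p)) \<le> L * (norm (x - p))\<^sup>2" if "p \<in> M" "x \<in> M" for p x
    using norm_nor_proj_le[OF assms(1-3) uniq that(1), where t="\<tau> / 4" and \<tau>="\<tau> / 2" and x=x] assms(5) that(2)
    by (simp add: L_def mult.commute)
  obtain \<epsilon> m where \<epsilon>: "\<epsilon> > 0" and m: "m > 0"
    and mass: "\<And>p s. p \<in> M \<Longrightarrow> 0 < s \<Longrightarrow> s < \<epsilon> \<Longrightarrow> ennreal (m * s ^ ?d) \<le> hausdorff ?d (M \<inter> ball p s)"
    using hausdorff_ball_uniform[OF assms(1,2)] by metis
  \<comment> \<open>As \<open>K > 1\<close>, any \<open>C1 \<ge> K\<close> has
    \<open>C1 ^ 2 \<ge> K\<close>, which is the exponent \<open>D + d + 2\<close> required of the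
    tail.\<close>
  define K where "K = 8 * real (?D + ?d + 2)"
  have K: "K > 1" by (simp add: K_def)
  show "\<exists>K > 1. \<forall>C1 \<ge> K. \<exists>C > 0. \<exists>\<sigma>0 > 0. \<forall>\<sigma>. 0 < \<sigma> \<and> \<sigma> < \<sigma>0 \<longrightarrow>
      (\<forall>z. infdist z M < C0 * \<sigma> \<longrightarrow>
         infdist (mu_V ?d M \<sigma> z (c * \<sigma>) (C1 * \<sigma> * sqrt (ln (1 / \<sigma>)))) M \<le> C * \<sigma>\<^sup>2 * ln (1 / \<sigma>))"
  proof (rule exI[of _ K], intro conjI K allI impI)
    fix C1 assume "K \<le> C1"
    then have C1: "0 < C1" "real (?D + ?d + 2) \<le> C1\<^sup>2 / 8"
    proof -
      have "K * 1 \<le> C1 * C1" using \<open>K \<le> C1\<close> K by (intro mult_mono) auto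
      then show "real (?D + ?d + 2) \<le> C1\<^sup>2 / 8" by (simp add: K_def power2_eq_square)
    qed (use K in simp)
    define H where "H = measure \<mu> UNIV"
    \<comment> \<open>The curvature and tail coefficients of the conditional mean; the added
      \<open>1\<close> makes positivity immediate.\<close>
    define C where "C = 9 * L * C1\<^sup>2 + H / (exp (- (C0 + 2)\<^sup>2 / 2) * m * c ^ ?D) + 1"
    have C: "C > 0" unfolding C_def using L m c by (intro add_nonneg_pos add_nonneg_nonneg) (auto simp: H_def)
    \<comment> \<open>The two bounds on \<open>r2\<close>: \<open>1 / 5\<close> for the volume of
      the box, and \<open>9 * L * r2 \<le> 1 / 8\<close> for the reflection argument, with
      \<open>L + 1\<close> ensuring a positive denominator.\<close>
    define \<delta> where "\<delta> = min (1 / 5) (1 / (72 * (L + 1)))"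
    have "0 < \<delta>" using L by (simp add: \<delta>_def)
    obtain \<sigma>0 where \<sigma>0: "0 < \<sigma>0" and small: "\<And>\<sigma>. 0 < \<sigma> \<Longrightarrow> \<sigma> < \<sigma>0 \<Longrightarrow> \<sigma> < min \<epsilon> 1 \<and> 1 \<le> ln (1 / \<sigma>)
        \<and> C1 * \<sigma> * sqrt (ln (1 / \<sigma>)) \<le> \<delta> \<and> (8 * C0) * \<sigma> \<le> C1 * \<sigma> * sqrt (ln (1 / \<sigma>))"
      using box_scale_eventually[of "min \<epsilon> 1" C1 \<delta> "8 * C0"] \<epsilon> C1 \<open>0 < \<delta>\<close> by (metis min_less_iff_conj zero_less_one)
    show "\<exists>C > 0. \<exists>\<sigma>0 > 0. \<forall>\<sigma>. 0 < \<sigma> \<and> \<sigma> < \<sigma>0 \<longrightarrow>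
      (\<forall>z. infdist z M < C0 * \<sigma> \<longrightarrow>
         infdist (mu_V ?d M \<sigma> z (c * \<sigma>) (C1 * \<sigma> * sqrt (ln (1 / \<sigma>)))) M \<le> C * \<sigma>\<^sup>2 * ln (1 / \<sigma>))"
    proof (rule exI[of _ C], rule conjI[OF C], rule exI[of _ \<sigma>0], intro conjI \<sigma>0 allI impI)
      fix \<sigma> z assume \<sigma>: "0 < \<sigma> \<and> \<sigma> < \<sigma>0" and z: "infdist z M < C0 * \<sigma>"
      define r2 where "r2 = C1 * \<sigma> * sqrt (ln (1 / \<sigma>))"
      have s: "\<sigma> < \<epsilon>" "\<sigma> < 1" "1 \<le> ln (1 / \<sigma>)" "r2 \<le> \<delta>" "8 * C0 * \<sigma> \<le> r2"
        using small[of \<sigma>] \<sigma> by (auto simp: r2_def)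
      have c\<sigma>: "4 * c * \<sigma> \<le> r2"
      proof -
        have "4 * c * \<sigma> \<le> 8 * C0 * \<sigma>" using c \<sigma> by (intro mult_right_mono) auto
        then show ?thesis using s by linarith
      qed
      have r2L: "9 * L * r2 \<le> 1 / 8"
      proof -
        have "9 * L * r2 \<le> 9 * L * (1 / (72 * (L + 1)))" using s L by (intro mult_left_mono) (auto simp: \<delta>_def)
        also have "\<dots> \<le> 1 / 8" using L by (simp add: field_simps)
        finally show ?thesis .
      qed
      define p where "p = nearest M z"
      have p: "p \<in> M" "dist z p = infdist z M" using nearest[OF assms(2,3)] by (auto simp: p_def)
      have T: "subspace (tangent_space M p)" by (rule subspace_tangent_space[OF assms(1) p(1)])
      interpret S: orthogonal_splitting "tan_proj M p"
        using linear_tan_proj[OF T] tan_proj[OF T]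
        by (intro orthogonal_splitting.intro) (auto simp: nor_proj_def inner_commute)
      have SQ: "S.Q = nor_proj M p" by (simp add: fun_eq_iff S.Q_def nor_proj_def)
      have box: "box_V M z r1 r2 = S.box z r1 r2" for r1 r2
        unfolding box_V_def S.box_def SQ p_def[symmetric] ..
      have zp: "tan_proj M p (z - p) = 0"
        using nearest_diff_normal[OF assms(2,3), of z] T by (simp add: p_def)
      have m\<sigma>: "m * \<sigma> ^ ?d \<le> measure \<mu> (ball p \<sigma>)"
      proof -
        have "ennreal (m * \<sigma> ^ ?d) \<le> emeasure \<mu> (ball p \<sigma>)"
          using mass[OF p(1), of \<sigma>] em[of "ball p \<sigma>"] \<sigma> s by (simp add: Int_commute)
        then show ?thesis by (simp add: \<mu>.emeasure_eq_measure ennreal_le_iff)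
      qed
      have AEq: "AE x in \<mu>. norm (S.Q (x - p)) \<le> L * (norm (x - p))\<^sup>2"
        using AEM by eventually_elim (simp add: SQ quad p)
      define G where "G y = (\<integral>x. gauss \<sigma> (y - x) \<partial>\<mu>)" for y
      define P where "P = (\<integral>y. indicator (S.box z (c * \<sigma>) r2) y *\<^sub>R G y \<partial>lborel)"
      define N where "N = (\<integral>y. indicator (S.box z (c * \<sigma>) r2) y *\<^sub>R G y *\<^sub>R S.Q (y - p) \<partial>lborel)"
      have bounds: "P > 0" "norm ((1 / P) *\<^sub>R N) \<le> 9 * L * C1\<^sup>2 * (\<sigma>\<^sup>2 * ln (1 / \<sigma>))
          + measure \<mu> UNIV / (exp (- (C0 + 2)\<^sup>2 / 2) * m * c ^ ?D) * \<sigma>\<^sup>2"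
        unfolding P_def N_def G_def
        by (rule S.norm_conditional_mean_le[OF fin sets _ _ _ _ _ r2_def _ c\<sigma> s(5) C1(2) _ L r2L AEq m m\<sigma>];
            use \<sigma> s c z p in \<open>simp add: \<delta>_def dist_norm\<close>)+
      have "0 < m * \<sigma> ^ ?d" using m \<sigma> by simp
      also have "\<dots> \<le> H" unfolding H_def using m\<sigma> \<mu>.bounded_measure[of "ball p \<sigma>"] by (simp add: sp)
      finally have H: "H > 0" .
      have "enn2real (hausdorff ?d M) = H" using em[of UNIV] by (simp add: H_def measure_def)
      then have nd: "noisy_density ?d M \<sigma> y = (1 / H) * G y" for y
        by (simp add: noisy_density_def G_def \<mu>_def)
      \<comment> \<open>The normalisation \<open>1 / H\<close> of the uniform law occurs in the
        numerator and in the mass, so it cancels; all estimates are for the unnormalised mixture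
        \<open>G\<close>.\<close>
      have "mu_V ?d M \<sigma> z (c * \<sigma>) r2
        = z + S.Q ((1 / (P / H)) *\<^sub>R (1 / H) *\<^sub>R (\<integral>y. indicator (S.box z (c * \<sigma>) r2) y *\<^sub>R G y *\<^sub>R (y - z) \<partial>lborel))"
      proof -
        have "(LINT y:S.box z (c * \<sigma>) r2|lborel. noisy_density ?d M \<sigma> y) = P / H"
          by (simp add: nd P_def set_lebesgue_integral_def)
        moreover have "(LINT y:S.box z (c * \<sigma>) r2|lborel. noisy_density ?d M \<sigma> y *\<^sub>R (y - z))
            = (\<integral>y. (1 / H) *\<^sub>R indicator (S.box z (c * \<sigma>) r2) y *\<^sub>R G y *\<^sub>R (y - z) \<partial>lborel)"
          unfolding set_lebesgue_integral_def nd
          by (intro Bochner_Integration.integral_cong refl) (simp add: mult_ac)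
        ultimately show ?thesis
          unfolding mu_V_def Let_def box p_def[symmetric] SQ by (simp only: integral_scaleR_right)
      qed
      also have "\<dots> = z + S.Q ((1 / P) *\<^sub>R (\<integral>y. indicator (S.box z (c * \<sigma>) r2) y *\<^sub>R G y *\<^sub>R (y - z) \<partial>lborel))"
        using H by simp
      also have "\<dots> = p + (1 / P) *\<^sub>R N"
        unfolding P_def N_def G_def
        using S.normal_conditional_mean_eq[OF fin sets zp] bounds(1) unfolding P_def G_def by auto
      finally have "infdist (mu_V ?d M \<sigma> z (c * \<sigma>) r2) M \<le> norm ((1 / P) *\<^sub>R N)"
        using infdist_le[OF p(1), of "p + (1 / P) *\<^sub>R N"] by (simp add: dist_norm)
      also have "\<dots> \<le> 9 * L * C1\<^sup>2 * (\<sigma>\<^sup>2 * ln (1 / \<sigma>)) + H / (exp (- (C0 + 2)\<^sup>2 / 2) * m * c ^ ?D) * \<sigma>\<^sup>2"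
        using bounds(2) by (simp add: H_def)
      also have "\<dots> \<le> 9 * L * C1\<^sup>2 * (\<sigma>\<^sup>2 * ln (1 / \<sigma>)) + H / (exp (- (C0 + 2)\<^sup>2 / 2) * m * c ^ ?D) * (\<sigma>\<^sup>2 * ln (1 / \<sigma>))
          + 1 * (\<sigma>\<^sup>2 * ln (1 / \<sigma>))"
      proof -
        have "\<sigma>\<^sup>2 * 1 \<le> \<sigma>\<^sup>2 * ln (1 / \<sigma>)" using s by (intro mult_left_mono) auto
        then have "H / (exp (- (C0 + 2)\<^sup>2 / 2) * m * c ^ ?D) * \<sigma>\<^sup>2 \<le> H / (exp (- (C0 + 2)\<^sup>2 / 2) * m * c ^ ?D) * (\<sigma>\<^sup>2 * ln (1 / \<sigma>))"
          using H m c by (intro mult_left_mono) auto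
        moreover have "0 \<le> \<sigma>\<^sup>2 * ln (1 / \<sigma>)" using s by simp
        ultimately show ?thesis by linarith
      qed
      also have "\<dots> = C * \<sigma>\<^sup>2 * ln (1 / \<sigma>)" unfolding C_def by (simp only: distrib_right mult.assoc)
      finally show "infdist (mu_V ?d M \<sigma> z (c * \<sigma>) (C1 * \<sigma> * sqrt (ln (1 / \<sigma>)))) M \<le> C * \<sigma>\<^sup>2 * ln (1 / \<sigma>)"
        unfolding r2_def .
    qed
  qed
qed

end
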